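(* Let $n\ge 2$ and $\delta>0$. There exists a constant $C=C(n,\delta)$, depending only on $n$ and $\delta$, such that the following holds. Let $R>0$, $x_0\in\mathbf{R}^{n+1}$, let $V\in\mathbf{R}^{n+1}$ be a constant unit vector, and let $\Sigma^n\subset\mathbf{R}^{n+1}$ be any smooth properly embedded translator such that $w=\langle V,\mathbf{n}\rangle\ge\delta$ on $B_R(x_0)\cap\Sigma$. Then $$|A|^2(x)\le C\Big(\frac1R+\frac1{R^2}\Big)w^2(x)\qquad\text{for all }x\in B_{R/2}(x_0)\cap\Sigma .$$
   Context: For a smooth hypersurface $\Sigma^n\subset\mathbf{R}^{n+1}$ (without boundary), $\mathbf{n}$ denotes a smooth global unit normal field, $A$ the second fundamental form, $|A|$ its norm, and $H=\mathrm{div}_\Sigma\,\mathbf{n}$ the mean curvature. $\Sigma$ is a translator (translating soliton of mean curvature flow) if $H=-\langle e_{n+1},\mathbf{n}\rangle$ on $\Sigma$, where $e_{n+1}$ is the last standard basis vector of $\mathbf{R}^{n+1}$. $B_r(x_0)$ denotes the closed ball of radius $r$ in $\mathbf{R}^{n+1}$ centered at $x_0$. *)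

theory Defs
  imports "HOL-Analysis.Analysis"
begin

text \<open>
  The ambient space \<open>\<real>\<^sup>n\<^sup>+\<^sup>1\<close> is \<open>(real ^ 'n) \<times> real\<close> with \<open>n = CARD('n)\<close>; its library norm and inner
  product are the Euclidean ones, and the last standard basis vector is \<open>(0, 1)\<close>.
\<close>

type_synonym 'n ambient = "(real ^ 'n) \<times> real"

text \<open>The following two notions are meant for open \<open>S\<close>, where the derivative \<open>at x\<close> is unique.\<close>

primrec Ck_on :: "nat \<Rightarrow> ('a::euclidean_space \<Rightarrow> 'b::euclidean_space) \<Rightarrow> 'a set \<Rightarrow> bool" where
  "Ck_on 0 f S \<longleftrightarrow> continuous_on S f"
| "Ck_on (Suc k) f S \<longleftrightarrow>
     (\<forall>x\<in>S. f differentiable (at x)) \<and> (\<forall>v. Ck_on k (\<lambda>x. frechet_derivative f (at x) v) S)"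

definition smooth_on :: "('a::euclidean_space \<Rightarrow> 'b::euclidean_space) \<Rightarrow> 'a set \<Rightarrow> bool" where
  "smooth_on f S \<longleftrightarrow> (\<forall>k. Ck_on k f S)"

text \<open>Embedded hypersurface without boundary: locally the homeomorphic image of an open subset of
  \<open>\<real>\<^sup>n\<close> under a smooth immersion.\<close>

definition smooth_hypersurface :: "('n::finite) ambient set \<Rightarrow> bool" where
  "smooth_hypersurface S \<longleftrightarrow>
     (\<forall>p\<in>S. \<exists>(W :: 'n ambient set) (U :: (real ^ 'n) set) \<phi> \<psi>.
        open W \<and> p \<in> W \<and> open U \<and> smooth_on \<phi> U \<and>
        (\<forall>u\<in>U. inj (frechet_derivative \<phi> (at u))) \<and>
        homeomorphism U (S \<inter> W) \<phi> \<psi>)"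

text \<open>Proper embedding: the inclusion map of \<open>S\<close> into the ambient space is proper.\<close>

definition properly_embedded :: "('n::finite) ambient set \<Rightarrow> bool" where
  "properly_embedded S \<longleftrightarrow>
     smooth_hypersurface S \<and> proper_map (top_of_set S) euclidean (\<lambda>x. x)"

text \<open>The tangent space at \<open>p\<close>, as the set of velocities of smooth curves in \<open>S\<close> through \<open>p\<close>.\<close>

definition tangent_space :: "'a::euclidean_space set \<Rightarrow> 'a \<Rightarrow> 'a set" where
  "tangent_space S p =
     {v. \<exists>\<gamma> e. 0 < e \<and> smooth_on \<gamma> {-e<..<e::real} \<and> \<gamma> ` {-e<..<e} \<subseteq> S \<and> \<gamma> 0 = p \<and>
            (\<gamma> has_vector_derivative v) (at 0)}"

definition smooth_along :: "('a::euclidean_space \<Rightarrow> 'b::euclidean_space) \<Rightarrow> 'a set \<Rightarrow> bool" where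
  "smooth_along f S \<longleftrightarrow>
     (\<forall>p\<in>S. \<exists>W F. open W \<and> p \<in> W \<and> smooth_on F W \<and> (\<forall>x\<in>S \<inter> W. F x = f x))"

definition unit_normal_field :: "'a::euclidean_space set \<Rightarrow> ('a \<Rightarrow> 'a) \<Rightarrow> bool" where
  "unit_normal_field S \<nu> \<longleftrightarrow>
     smooth_along \<nu> S \<and>
     (\<forall>p\<in>S. norm (\<nu> p) = 1 \<and> (\<forall>v\<in>tangent_space S p. \<nu> p \<bullet> v = 0))"

text \<open>The derivative of \<open>f\<close> along \<open>S\<close>. A Frechet derivative within \<open>S\<close> is not unique as a linear map
  on the ambient space, but its values on tangent vectors are; see the lemma below. We use it on
  tangent vectors only.\<close>

definition tangential_derivative ::
    "'a::euclidean_space set \<Rightarrow> ('a \<Rightarrow> 'b::euclidean_space) \<Rightarrow> 'a \<Rightarrow> 'a \<Rightarrow> 'b" where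
  "tangential_derivative S f p v = frechet_derivative f (at p within S) v"

lemma tangential_derivative_eq:
  assumes D: "(f has_derivative D) (at p within S)" and v: "v \<in> tangent_space S p"
  shows "tangential_derivative S f p v = D v"
proof -
  obtain \<gamma> e where g: "0 < e" "\<gamma> ` {-e<..<e::real} \<subseteq> S" "\<gamma> 0 = p"
    "(\<gamma> has_vector_derivative v) (at 0)"
    using v unfolding tangent_space_def by blast
  have *: "((\<lambda>t. f (\<gamma> t)) has_vector_derivative D' v) (at 0)"
    if D': "(f has_derivative D') (at p within S)" for D'
  proof -
    let ?I = "{-e<..<e}"
    have 1: "(\<gamma> has_derivative (\<lambda>t. t *\<^sub>R v)) (at 0 within ?I)"
      using g(4) unfolding has_vector_derivative_def by (rule has_derivative_at_withinI)
    have 2: "(f has_derivative D') (at (\<gamma> 0) within \<gamma> ` ?I)"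
      unfolding g(3) by (rule has_derivative_subset[OF D' g(2)])
    have 3: "D' (t *\<^sub>R v) = t *\<^sub>R D' v" for t
      by (rule linear_cmul[OF has_derivative_linear[OF D']])
    have 4: "at 0 within ?I = at (0::real)"
      by (rule at_within_open) (use g(1) in auto)
    from diff_chain_within[OF 1 2] show ?thesis
      by (simp only: has_vector_derivative_def comp_def 3 4)
  qed
  have "(f has_derivative frechet_derivative f (at p within S)) (at p within S)"
    using differentiableI[OF D] by (simp add: frechet_derivative_works)
  from *[OF this] *[OF D] show ?thesis
    unfolding tangential_derivative_def by (rule vector_derivative_unique_at)
qed

definition second_fundamental_form ::
    "'a::euclidean_space set \<Rightarrow> ('a \<Rightarrow> 'a) \<Rightarrow> 'a \<Rightarrow> 'a \<Rightarrow> 'a \<Rightarrow> real" where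
  "second_fundamental_form S \<nu> p X Y = tangential_derivative S \<nu> p X \<bullet> Y"

definition orthonormal_basis_of :: "'a::euclidean_space set \<Rightarrow> 'a set \<Rightarrow> bool" where
  "orthonormal_basis_of T B \<longleftrightarrow>
     pairwise orthogonal B \<and> (\<forall>b\<in>B. norm b = 1) \<and> B \<subseteq> T \<and> span B = T"

text \<open>The traces and norms below do not depend on the chosen orthonormal basis.\<close>

definition tangent_basis :: "'a::euclidean_space set \<Rightarrow> 'a \<Rightarrow> 'a set" where
  "tangent_basis S p = (SOME B. orthonormal_basis_of (tangent_space S p) B)"

definition tangential_divergence :: "'a::euclidean_space set \<Rightarrow> ('a \<Rightarrow> 'a) \<Rightarrow> 'a \<Rightarrow> real" where
  "tangential_divergence S X p = (\<Sum>b\<in>tangent_basis S p. tangential_derivative S X p b \<bullet> b)"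

definition mean_curvature :: "'a::euclidean_space set \<Rightarrow> ('a \<Rightarrow> 'a) \<Rightarrow> 'a \<Rightarrow> real" where
  "mean_curvature S \<nu> p = tangential_divergence S \<nu> p"

definition norm_second_fundamental_form ::
    "'a::euclidean_space set \<Rightarrow> ('a \<Rightarrow> 'a) \<Rightarrow> 'a \<Rightarrow> real" where
  "norm_second_fundamental_form S \<nu> p =
     sqrt (\<Sum>b\<in>tangent_basis S p. \<Sum>c\<in>tangent_basis S p. (second_fundamental_form S \<nu> p b c)\<^sup>2)"

definition translator :: "('n::finite) ambient set \<Rightarrow> ('n ambient \<Rightarrow> 'n ambient) \<Rightarrow> bool" where
  "translator S \<nu> \<longleftrightarrow>
     smooth_hypersurface S \<and> unit_normal_field S \<nu> \<and>
     (\<forall>p\<in>S. mean_curvature S \<nu> p = - ((0, 1) \<bullet> \<nu> p))"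

end

theory Submission
  imports Defs
begin

text \<open>
  A maximum principle of Ecker--Huisken type, run on the principal curvatures instead of \<open>|A|\<^sup>2\<close>.
  With \<open>a = \<delta> / 2\<close> and \<open>\<eta> = R\<^sup>2 - |x - x\<^sub>0|\<^sup>2\<close>, maximise \<open>\<eta> |A(X, X)| / (w - a)\<close> over the unit tangent
  vectors \<open>X\<close> at points of \<open>\<Sigma>\<close> in the ball, a compact set since \<open>\<Sigma>\<close> is proper. At a maximum \<open>X\<close> is a
  principal direction, and writing \<open>\<Sigma>\<close> as a graph of \<open>u\<close> over its tangent plane there, the translator
  equation becomes
  \<open>(1 + |Du|\<^sup>2) \<Delta>u - u\<^sub>i u\<^sub>j u\<^sub>i\<^sub>j = (1 + |Du|\<^sup>2) (e\<^sub>\<nu> - e\<^sub>i u\<^sub>i)\<close>. Differentiating it once and twice at the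
  origin, where \<open>Du = 0\<close>, gives \<open>L w = -|A|\<^sup>2 w\<close> and \<open>L \<kappa> = -|A|\<^sup>2 \<kappa>\<close> for the drift Laplacian \<open>L\<close>, while
  \<open>L |x - x\<^sub>0|\<^sup>2 \<le> 2n + 2R\<close>. The second derivative test then leaves the good term \<open>a |A|\<^sup>2\<close>, which bounds
  \<open>\<eta>\<^sup>2 |A|\<^sup>2\<close> at the maximum by a multiple of \<open>R\<^sup>2 (1 + R)\<close>.
\<close>

section \<open>Smooth functions\<close>

text \<open>Working with A(X, X) for one vector X keeps the test functions linear in the second
  derivatives of u; a computation with |A|^2 would need control of the gradient of A. The usual
  price, a moving field of eigenvectors, is avoided: a fixed coordinate direction, lifted to each
  nearby tangent plane, is already a competitor in the maximum.

  The shift by a produces the estimate. For the quotient by w alone the two zero-order terms cancel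
  and nothing controls |A|; with w - a they leave a |A|^2. Half of \<delta> keeps the denominator at
  least a. In graph coordinates the area element W divides both A(X, X) and w, so after
  multiplication by W it survives only in a W, whose Laplacian at the centre is a |A|^2.

  Since \<eta> vanishes on the sphere, a positive maximum is interior. On the half ball \<eta> is at
  least 3 R^2 / 4, and R^2 (1 + R) / R^4 = 1/R + 1/R^2.

  Smoothness is an iterated-derivative predicate, so its closure under products, quotients and local
  inverses has to be established by induction on the order.\<close>

definition dird :: "'a::euclidean_space \<Rightarrow> ('a \<Rightarrow> 'b::euclidean_space) \<Rightarrow> 'a \<Rightarrow> 'b" where
  "dird v f = (\<lambda>x. frechet_derivative f (at x) v)"

lemma dird_eqI: "(f has_derivative D) (at x) \<Longrightarrow> dird v f x = D v"
  unfolding dird_def using frechet_derivative_at by metis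

lemma dird_has_derivative:
  "f differentiable (at x) \<Longrightarrow> (f has_derivative (\<lambda>v. dird v f x)) (at x)"
  unfolding dird_def by (simp add: frechet_derivative_works)

lemma linear_dird: "f differentiable (at x) \<Longrightarrow> linear (\<lambda>v. dird v f x)"
  using dird_has_derivative has_derivative_linear by blast

lemma dird_cong:
  assumes "open S" "x \<in> S" "\<And>y. y \<in> S \<Longrightarrow> f y = g y"
  shows "dird v f x = dird v g x"
proof -
  have "(f has_derivative D) (at x) \<longleftrightarrow> (g has_derivative D) (at x)" for D
    using assms has_derivative_transform_within_open[of f D x UNIV S g]
      has_derivative_transform_within_open[of g D x UNIV S f] by auto
  then show ?thesis unfolding dird_def frechet_derivative_def by presburger
qed

lemma differentiable_cong_open:
  assumes "open S" "x \<in> S" "\<And>y. y \<in> S \<Longrightarrow> f y = g y"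
  shows "f differentiable (at x) \<longleftrightarrow> g differentiable (at x)"
proof -
  have "(f has_derivative D) (at x) \<longleftrightarrow> (g has_derivative D) (at x)" for D
    using assms has_derivative_transform_within_open[of f D x UNIV S g]
      has_derivative_transform_within_open[of g D x UNIV S f] by auto
  then show ?thesis unfolding differentiable_def by presburger
qed

lemma Ck_on_Suc_dird:
  "Ck_on (Suc k) f S \<longleftrightarrow> (\<forall>x\<in>S. f differentiable (at x)) \<and> (\<forall>v. Ck_on k (dird v f) S)"
  by (simp add: dird_def)

declare Ck_on.simps(2) [simp del]

lemma Ck_on_Suc_imp: "Ck_on (Suc k) f S \<Longrightarrow> Ck_on k f S"
proof (induction k arbitrary: f)
  case 0
  then have "f differentiable (at x)" if "x \<in> S" for x using that unfolding Ck_on_Suc_dird by blast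
  then show ?case
    by (simp add: continuous_at_imp_continuous_on differentiable_imp_continuous_within)
next
  case (Suc k)
  then show ?case by (metis Ck_on_Suc_dird)
qed

lemma Ck_on_cong:
  assumes "open S" "\<And>x. x \<in> S \<Longrightarrow> f x = g x"
  shows "Ck_on k f S \<longleftrightarrow> Ck_on k g S"
  using assms(2)
proof (induction k arbitrary: f g)
  case 0
  then show ?case unfolding Ck_on.simps by (intro continuous_on_cong refl)
next
  case (Suc k)
  have "Ck_on k (dird v f) S \<longleftrightarrow> Ck_on k (dird v g) S" for v
    using dird_cong[OF assms(1) _ Suc.prems] by (rule Suc.IH)
  moreover have "f differentiable (at x) \<longleftrightarrow> g differentiable (at x)" if "x \<in> S" for x
    using Suc.prems by (rule differentiable_cong_open[OF assms(1) that])
  ultimately show ?case unfolding Ck_on_Suc_dird by simp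
qed

text \<open>Lets an inductive step work with a derivative given by a formula instead of the one
  selected by \<open>frechet_derivative\<close>; on an open set the two can be exchanged.\<close>

lemma Ck_on_SucI:
  assumes "open S" "\<And>x. x \<in> S \<Longrightarrow> (f has_derivative (\<lambda>v. D v x)) (at x)"
    and "\<And>v. Ck_on k (D v) S"
  shows "Ck_on (Suc k) f S"
proof -
  have "Ck_on k (dird v f) S" for v
    using assms(3) by (rule iffD1[OF Ck_on_cong[OF assms(1)], rotated]) (simp add: dird_eqI[OF assms(2)])
  then show ?thesis using assms(2) by (auto simp: Ck_on_Suc_dird differentiable_def)
qed

lemma Ck_on_const: "Ck_on k (\<lambda>x. c) S"
proof (induction k arbitrary: c)
  case (Suc k)
  have "dird v (\<lambda>x. c) = (\<lambda>x. 0)" for v :: 'a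
    by (rule ext) (rule dird_eqI[of _ "\<lambda>_. 0", OF has_derivative_const])
  with Suc show ?case by (simp add: Ck_on_Suc_dird)
qed simp

lemma Ck_on_linear_image:
  assumes "open S" "linear L" "Ck_on k f S"
  shows "Ck_on k (\<lambda>x. L (f x)) S"
  using assms(3)
proof (induction k arbitrary: f)
  case 0
  then show ?case
    using assms(2) by (simp add: linear_continuous_on_compose)
next
  case (Suc k)
  have d: "f differentiable (at x)" if "x \<in> S" for x
    using Suc.prems that by (simp add: Ck_on_Suc_dird)
  have D: "((\<lambda>x. L (f x)) has_derivative (\<lambda>v. L (dird v f x))) (at x)" if "x \<in> S" for x
    using assms(2)[unfolded linear_conv_bounded_linear] dird_has_derivative[OF d[OF that]]
    by (rule bounded_linear.has_derivative)
  have "Ck_on k (\<lambda>x. L (dird v f x)) S" for v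
    using Suc by (simp add: Ck_on_Suc_dird)
  then show ?case by (rule Ck_on_SucI[OF assms(1) D, rotated])
qed

lemma Ck_on_add:
  assumes "open S" "Ck_on k f S" "Ck_on k g S"
  shows "Ck_on k (\<lambda>x. f x + g x) S"
  using assms(2,3)
proof (induction k arbitrary: f g)
  case 0
  then show ?case by (simp add: continuous_on_add)
next
  case (Suc k)
  have D: "((\<lambda>x. f x + g x) has_derivative (\<lambda>v. dird v f x + dird v g x)) (at x)" if "x \<in> S" for x
    using Suc.prems that
    by (intro has_derivative_add dird_has_derivative) (auto simp: Ck_on_Suc_dird)
  have "Ck_on k (\<lambda>x. dird v f x + dird v g x) S" for v
    using Suc by (simp add: Ck_on_Suc_dird)
  then show ?case by (rule Ck_on_SucI[OF assms(1) D, rotated])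
qed

lemma Ck_on_mult:
  fixes f g :: "'a::euclidean_space \<Rightarrow> real"
  assumes "open S" "Ck_on k f S" "Ck_on k g S"
  shows "Ck_on k (\<lambda>x. f x * g x) S"
  using assms(2,3)
proof (induction k arbitrary: f g)
  case 0
  then show ?case by (simp add: continuous_on_mult)
next
  case (Suc k)
  have D: "((\<lambda>x. f x * g x) has_derivative (\<lambda>v. f x * dird v g x + dird v f x * g x)) (at x)"
    if "x \<in> S" for x
    using Suc.prems that
    by (intro has_derivative_mult dird_has_derivative) (auto simp: Ck_on_Suc_dird)
  have "Ck_on k (\<lambda>x. f x * dird v g x + dird v f x * g x) S" for v
    using Suc.prems Ck_on_Suc_imp[OF Suc.prems(1)] Ck_on_Suc_imp[OF Suc.prems(2)]
    by (intro Ck_on_add assms(1) Suc.IH) (simp_all add: Ck_on_Suc_dird)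
  then show ?case by (rule Ck_on_SucI[OF assms(1) D, rotated])
qed

text \<open>The derivative of 1/f contains 1/f itself, together with a derivative of f. The
  induction can therefore keep \<open>f\<close> fixed: the induction hypothesis supplies 1/f to
  order k.\<close>

lemma Ck_on_inverse:
  fixes f :: "'a::euclidean_space \<Rightarrow> real"
  assumes "open S" "\<And>x. x \<in> S \<Longrightarrow> f x \<noteq> 0" "Ck_on k f S"
  shows "Ck_on k (\<lambda>x. inverse (f x)) S"
  using assms(3)
proof (induction k)
  case 0
  then show ?case using assms(2) by (simp add: continuous_on_inverse)
next
  case (Suc k)
  have D: "((\<lambda>x. inverse (f x)) has_derivative
      (\<lambda>v. (- 1) * (inverse (f x) * dird v f x * inverse (f x)))) (at x)"
    if "x \<in> S" for x
    using Deriv.has_derivative_inverse[OF assms(2)[OF that] dird_has_derivative[of f x]]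
      Suc.prems that by (simp add: Ck_on_Suc_dird)
  have "Ck_on k (\<lambda>x. (- 1) * (inverse (f x) * dird v f x * inverse (f x))) S" for v
    using Suc.prems Ck_on_Suc_imp[OF Suc.prems] Suc.IH
    by (intro Ck_on_mult Ck_on_const assms(1)) (simp_all add: Ck_on_Suc_dird)
  then show ?case by (rule Ck_on_SucI[OF assms(1) D, rotated])
qed

lemma smooth_on_dird: "smooth_on f S \<Longrightarrow> smooth_on (dird v f) S"
  unfolding smooth_on_def using Ck_on_Suc_dird by blast

lemma smooth_on_differentiable: "smooth_on f S \<Longrightarrow> x \<in> S \<Longrightarrow> f differentiable (at x)"
  unfolding smooth_on_def using Ck_on_Suc_dird by blast

lemma smooth_on_continuous: "smooth_on f S \<Longrightarrow> continuous_on S f"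
  unfolding smooth_on_def using Ck_on.simps(1) by blast

lemma Ck_on_subset: "Ck_on k f S \<Longrightarrow> T \<subseteq> S \<Longrightarrow> Ck_on k f T"
  by (induction k arbitrary: f) (auto simp: Ck_on_Suc_dird intro: continuous_on_subset)

lemma smooth_on_subset: "smooth_on f S \<Longrightarrow> T \<subseteq> S \<Longrightarrow> smooth_on f T"
  unfolding smooth_on_def using Ck_on_subset by blast

lemma smooth_on_cong:
  "open S \<Longrightarrow> (\<And>x. x \<in> S \<Longrightarrow> f x = g x) \<Longrightarrow> smooth_on f S \<longleftrightarrow> smooth_on g S"
  unfolding smooth_on_def using Ck_on_cong by blast

lemma smooth_on_transform:
  "open S \<Longrightarrow> smooth_on g S \<Longrightarrow> (\<And>x. x \<in> S \<Longrightarrow> f x = g x) \<Longrightarrow> smooth_on f S"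
  using smooth_on_cong by blast

lemma smooth_on_const: "smooth_on (\<lambda>x. c) S"
  by (simp add: smooth_on_def Ck_on_const)

lemma smooth_on_linear_image:
  "open S \<Longrightarrow> linear L \<Longrightarrow> smooth_on f S \<Longrightarrow> smooth_on (\<lambda>x. L (f x)) S"
  by (simp add: smooth_on_def Ck_on_linear_image)

lemma smooth_on_add:
  "open S \<Longrightarrow> smooth_on f S \<Longrightarrow> smooth_on g S \<Longrightarrow> smooth_on (\<lambda>x. f x + g x) S"
  by (simp add: smooth_on_def Ck_on_add)

lemma smooth_on_mult:
  fixes f g :: "'a::euclidean_space \<Rightarrow> real"
  shows "open S \<Longrightarrow> smooth_on f S \<Longrightarrow> smooth_on g S \<Longrightarrow> smooth_on (\<lambda>x. f x * g x) S"
  by (simp add: smooth_on_def Ck_on_mult)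

lemma smooth_on_inverse:
  fixes f :: "'a::euclidean_space \<Rightarrow> real"
  shows "open S \<Longrightarrow> (\<And>x. x \<in> S \<Longrightarrow> f x \<noteq> 0) \<Longrightarrow> smooth_on f S \<Longrightarrow> smooth_on (\<lambda>x. inverse (f x)) S"
  by (simp add: smooth_on_def Ck_on_inverse)

lemma smooth_on_sum:
  assumes "open S" "\<And>i. i \<in> I \<Longrightarrow> smooth_on (f i) S"
  shows "smooth_on (\<lambda>x. \<Sum>i\<in>I. f i x) S"
  using assms(2)
  by (induction I rule: infinite_finite_induct)
    (auto simp: smooth_on_const intro!: smooth_on_add assms(1))

lemma smooth_on_prod:
  fixes f :: "'i \<Rightarrow> 'a::euclidean_space \<Rightarrow> real"
  assumes "open S" "\<And>i. i \<in> I \<Longrightarrow> smooth_on (f i) S"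
  shows "smooth_on (\<lambda>x. \<Prod>i\<in>I. f i x) S"
  using assms(2)
  by (induction I rule: infinite_finite_induct)
    (auto simp: smooth_on_const intro!: smooth_on_mult assms(1))

section \<open>Determinants, inverse linear maps and local inverses\<close>

lemma smooth_on_det:
  fixes A :: "'a::euclidean_space \<Rightarrow> real^'n^'n"
  assumes "open S" "\<And>i j. smooth_on (\<lambda>x. A x $ i $ j) S"
  shows "smooth_on (\<lambda>x. det (A x)) S"
  unfolding det_def
  by (intro smooth_on_sum smooth_on_mult smooth_on_prod smooth_on_const assms)

text \<open>Cramer's rule: each coordinate of the solution is a quotient of determinants, which are
  polynomials in smooth entries. In the proof \<open>B\<close> is the matrix with column
  \<open>k\<close> replaced by \<open>v\<close>.\<close>

lemma smooth_on_inverse_linear_apply: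
  fixes L :: "'a::euclidean_space \<Rightarrow> real^'n \<Rightarrow> real^'n"
  assumes S: "open S" and lin: "\<And>x. x \<in> S \<Longrightarrow> linear (L x)" and bij: "\<And>x. x \<in> S \<Longrightarrow> bij (L x)"
    and sm: "\<And>v. smooth_on (\<lambda>x. L x v) S"
  shows "smooth_on (\<lambda>x. inv (L x) v $ k) S"
proof -
  define A where "A x = matrix (L x)" for x
  define B where "B x = (\<chi> i j. if j = k then v $ i else A x $ i $ j)" for x
  have A: "smooth_on (\<lambda>x. A x $ i $ j) S" for i j
    unfolding A_def matrix_def using smooth_on_linear_image[OF S _ sm, of "\<lambda>y. y $ i" "axis j 1"]
    by (simp add: linear_iff)
  then have B: "smooth_on (\<lambda>x. B x $ i $ j) S" for i j
    unfolding B_def by (cases "j = k") (simp_all add: smooth_on_const)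
  have det: "det (A x) \<noteq> 0" if "x \<in> S" for x
    using lin[OF that] bij[OF that] det_nz_iff_inj[of "L x"] by (simp add: A_def bij_is_inj)
  have eq: "inv (L x) v $ k = det (B x) * inverse (det (A x))" if "x \<in> S" for x
  proof -
    have "A x *v inv (L x) v = v"
      using lin[OF that] bij[OF that] by (simp add: A_def matrix_works bij_is_surj surj_f_inv_f)
    then have "inv (L x) v = (\<chi> k. det(\<chi> i j. if j=k then v$i else A x$i$j) / det (A x))"
      using cramer[OF det[OF that]] by blast
    then show ?thesis by (simp add: B_def divide_inverse)
  qed
  have "smooth_on (\<lambda>x. det (B x) * inverse (det (A x))) S"
    by (intro smooth_on_mult smooth_on_inverse smooth_on_det A B S det)
  then show ?thesis by (rule smooth_on_transform[OF S _ eq])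
qed

lemma dird_axis_expansion:
  fixes f :: "real^'n \<Rightarrow> real"
  assumes "f differentiable (at x)"
  shows "dird v f x = (\<Sum>i\<in>UNIV. v $ i * dird (axis i 1) f x)"
proof -
  note lin = linear_dird[OF assms]
  have "dird v f x = dird (\<Sum>i\<in>UNIV. v $ i *\<^sub>R axis i 1) f x"
    using basis_expansion[of v] by (simp add: scalar_mult_eq_scaleR)
  then show ?thesis
    using linear_sum[OF lin, of "\<lambda>i. v $ i *\<^sub>R axis i 1" UNIV] linear_cmul[OF lin] by simp
qed

text \<open>Generalising over \<open>m\<close> makes the induction work without a chain rule for \<open>Ck_on\<close>: the derivative of
  \<open>m \<circ> g\<close> is again of the form \<open>m' \<circ> g\<close>.\<close>

lemma smooth_on_compose_local_inverse:
  fixes T :: "real^'n \<Rightarrow> real^'n" and m :: "real^'n \<Rightarrow> real"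
  assumes S: "open S" and V: "open V" and T: "smooth_on T S" and gS: "g ` V \<subseteq> S"
    and bij: "\<And>x. x \<in> S \<Longrightarrow> bij (\<lambda>v. dird v T x)"
    and g: "\<And>y. y \<in> V \<Longrightarrow> (g has_derivative inv (\<lambda>v. dird v T (g y))) (at y)"
    and m: "smooth_on m S"
  shows "smooth_on (\<lambda>y. m (g y)) V"
proof -
  have "Ck_on k (\<lambda>y. m (g y)) V" if "smooth_on m S" for k and m :: "real^'n \<Rightarrow> real"
    using that
  proof (induction k arbitrary: m)
    case 0
    have "continuous_on V g"
      using g by (meson continuous_at_imp_continuous_on has_derivative_continuous)
    then show ?case
      using smooth_on_continuous[OF 0] gS by (auto intro: continuous_on_compose2)
  next
    case (Suc k)
    define M where "M v x = dird (inv (\<lambda>v. dird v T x) v) m x" for v x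
    have D: "((\<lambda>y. m (g y)) has_derivative (\<lambda>v. M v (g y))) (at y)" if "y \<in> V" for y
      using diff_chain_at[OF g[OF that] dird_has_derivative[OF smooth_on_differentiable[OF Suc.prems]]]
        that gS by (auto simp: M_def o_def)
    have lin: "linear (\<lambda>v. dird v T x)" if "x \<in> S" for x
      using linear_dird smooth_on_differentiable[OF T that] by blast
    have eq: "M v x = (\<Sum>i\<in>UNIV. inv (\<lambda>v. dird v T x) v $ i * dird (axis i 1) m x)"
      if "x \<in> S" for v x
      unfolding M_def by (rule dird_axis_expansion[OF smooth_on_differentiable[OF Suc.prems that]])
    have "smooth_on (\<lambda>x. \<Sum>i\<in>UNIV. inv (\<lambda>v. dird v T x) v $ i * dird (axis i 1) m x) S" for v
      by (intro smooth_on_sum smooth_on_mult S smooth_on_dird Suc.prems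
          smooth_on_inverse_linear_apply lin bij T)
    then have "smooth_on (M v) S" for v by (rule smooth_on_transform[OF S _ eq])
    then have "Ck_on k (\<lambda>y. M v (g y)) V" for v
      using Suc.IH by blast
    then show ?case by (rule Ck_on_SucI[OF V D, rotated])
  qed
  then show ?thesis using m by (simp add: smooth_on_def)
qed

section \<open>Symmetry of second derivatives\<close>

lemma dird_line:
  fixes f :: "'a::euclidean_space \<Rightarrow> real"
  assumes "f differentiable (at (x + t *\<^sub>R v))"
  shows "((\<lambda>t. f (x + t *\<^sub>R v)) has_real_derivative dird v f (x + t *\<^sub>R v)) (at t)"
proof -
  have 1: "((\<lambda>t. x + t *\<^sub>R v) has_derivative (\<lambda>h. h *\<^sub>R v)) (at t)"
    by (auto intro!: derivative_eq_intros)
  have "((\<lambda>t. f (x + t *\<^sub>R v)) has_derivative (\<lambda>h. dird (h *\<^sub>R v) f (x + t *\<^sub>R v))) (at t)"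
    using diff_chain_at[OF 1 dird_has_derivative[OF assms]] by (simp add: o_def)
  then show ?thesis
    using linear_cmul[OF linear_dird[OF assms]]
    by (simp add: has_field_derivative_def mult_commute_abs)
qed

text \<open>Two mean value steps, in direction \<open>v\<close> and then in direction
  \<open>w\<close>. The second difference is symmetric in the two vectors, so exchanging them
  realises the same number by the mixed derivative in the other order.\<close>

lemma second_difference_mean_value:
  fixes f :: "'a::euclidean_space \<Rightarrow> real"
  assumes S: "ball x r \<subseteq> S" and f: "smooth_on f S" and t: "0 < t" "t * (norm v + norm w) < r"
  shows "\<exists>z\<in>ball x r. f (x + t *\<^sub>R v + t *\<^sub>R w) - f (x + t *\<^sub>R v) - (f (x + t *\<^sub>R w) - f x)
           = t * t * dird w (dird v f) z"
proof -
  have mem: "x + a *\<^sub>R v + b *\<^sub>R w \<in> ball x r" if "0 \<le> a" "a \<le> t" "0 \<le> b" "b \<le> t" for a b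
  proof -
    have "norm (a *\<^sub>R v + b *\<^sub>R w) \<le> a * norm v + b * norm w"
      using norm_triangle_ineq[of "a *\<^sub>R v" "b *\<^sub>R w"] that by simp
    also have "\<dots> \<le> t * norm v + t * norm w"
      using that by (intro add_mono mult_right_mono) auto
    also have "\<dots> < r" using t by (simp add: distrib_left)
    finally show ?thesis by (simp add: dist_norm add.assoc norm_minus_commute add.commute[of "a *\<^sub>R v"])
  qed
  have diff: "h differentiable (at (x + a *\<^sub>R v + b *\<^sub>R w))"
    if "0 \<le> a" "a \<le> t" "0 \<le> b" "b \<le> t" "smooth_on h S" for a b and h :: "'a \<Rightarrow> real"
    using smooth_on_differentiable[OF that(5)] mem that S by blast
  define G where "G a = f (x + a *\<^sub>R v + t *\<^sub>R w) - f (x + a *\<^sub>R v)" for a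
  have "(G has_real_derivative dird v f (x + a *\<^sub>R v + t *\<^sub>R w) - dird v f (x + a *\<^sub>R v)) (at a)"
    if "0 \<le> a" "a \<le> t" for a
  proof -
    have 1: "((\<lambda>a. f (x + t *\<^sub>R w + a *\<^sub>R v)) has_real_derivative dird v f (x + t *\<^sub>R w + a *\<^sub>R v)) (at a)"
      using diff[OF that _ _ f, of t] t by (intro dird_line) (simp add: ac_simps)
    have 2: "((\<lambda>a. f (x + a *\<^sub>R v)) has_real_derivative dird v f (x + a *\<^sub>R v)) (at a)"
      using diff[OF that _ _ f, of 0] t by (intro dird_line) simp
    show ?thesis unfolding G_def using DERIV_diff[OF 1 2] by (simp add: ac_simps)
  qed
  from MVT2[OF t(1) this] obtain a where a: "0 < a" "a < t"
    "G t - G 0 = t * (dird v f (x + a *\<^sub>R v + t *\<^sub>R w) - dird v f (x + a *\<^sub>R v))"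
    by auto
  have "((\<lambda>b. dird v f (x + a *\<^sub>R v + b *\<^sub>R w)) has_real_derivative
           dird w (dird v f) (x + a *\<^sub>R v + b *\<^sub>R w)) (at b)" if "0 \<le> b" "b \<le> t" for b
    using diff[OF _ _ that smooth_on_dird[OF f], of a] a by (intro dird_line) simp
  from MVT2[OF t(1) this] obtain b where b: "0 < b" "b < t"
    "dird v f (x + a *\<^sub>R v + t *\<^sub>R w) - dird v f (x + a *\<^sub>R v)
      = t * dird w (dird v f) (x + a *\<^sub>R v + b *\<^sub>R w)"
    by auto
  show ?thesis
    using a b mem[of a b] by (intro bexI[of _ "x + a *\<^sub>R v + b *\<^sub>R w"]) (auto simp: G_def)
qed

text \<open>On a small ball each mixed derivative stays within half of their supposed gap from its
  value at \<open>x\<close>; yet at two points of that ball they both equal the same second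
  difference divided by t^2.\<close>

lemma dird_commute:
  fixes f :: "'a::euclidean_space \<Rightarrow> real"
  assumes S: "open S" "x \<in> S" and f: "smooth_on f S"
  shows "dird v (dird w f) x = dird w (dird v f) x"
proof (rule ccontr)
  assume ne: "\<not> ?thesis"
  define \<epsilon> where "\<epsilon> = \<bar>dird v (dird w f) x - dird w (dird v f) x\<bar> / 2"
  have \<epsilon>: "\<epsilon> > 0" using ne by (simp add: \<epsilon>_def)
  have "\<exists>r>0. \<forall>z\<in>ball x r. z \<in> S \<and> \<bar>dird a (dird b f) z - dird a (dird b f) x\<bar> < \<epsilon>" for a b
  proof -
    have "continuous (at x) (dird a (dird b f))"
      using smooth_on_continuous[OF smooth_on_dird[OF smooth_on_dird[OF f]]] S
        continuous_on_eq_continuous_at by blast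
    then obtain d where "d > 0" "\<And>z. dist z x < d \<Longrightarrow> \<bar>dird a (dird b f) z - dird a (dird b f) x\<bar> < \<epsilon>"
      using \<epsilon> unfolding continuous_at_eps_delta dist_real_def by meson
    moreover obtain r where "r > 0" "ball x r \<subseteq> S" using S openE by blast
    ultimately show ?thesis
      by (intro exI[of _ "min d r"]) (auto simp: dist_commute)
  qed
  then obtain r1 r2 where r1: "r1 > 0" "\<And>z. z \<in> ball x r1 \<Longrightarrow>
       z \<in> S \<and> \<bar>dird v (dird w f) z - dird v (dird w f) x\<bar> < \<epsilon>"
    and r2: "r2 > 0" "\<And>z. z \<in> ball x r2 \<Longrightarrow>
       z \<in> S \<and> \<bar>dird w (dird v f) z - dird w (dird v f) x\<bar> < \<epsilon>" by metis
  define r where "r = min r1 r2"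
  \<comment> \<open>Small enough for the parallelogram spanned by \<open>t *\<^sub>R v\<close> and
    \<open>t *\<^sub>R w\<close> to stay in the ball; the added 1 keeps the denominator positive
    when both vectors vanish.\<close>
  define t where "t = r / (norm v + norm w + 1)"
  have r: "r > 0" using r1 r2 by (simp add: r_def)
  have n: "norm v + norm w + 1 > 0" by (simp add: add_nonneg_pos)
  have t: "t > 0" using r n by (simp add: t_def)
  have "t * (norm v + norm w) < t * (norm v + norm w + 1)" using t by simp
  also have "\<dots> = r" using n by (simp add: t_def)
  finally have tr: "t * (norm v + norm w) < r" .
  have sub: "ball x r \<subseteq> S" using r1 by (auto simp: r_def)
  obtain z1 where z1: "z1 \<in> ball x r"
    "f (x + t *\<^sub>R v + t *\<^sub>R w) - f (x + t *\<^sub>R v) - (f (x + t *\<^sub>R w) - f x) = t * t * dird w (dird v f) z1"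
    using second_difference_mean_value[OF sub f t tr] by blast
  obtain z2 where z2: "z2 \<in> ball x r"
    "f (x + t *\<^sub>R w + t *\<^sub>R v) - f (x + t *\<^sub>R w) - (f (x + t *\<^sub>R v) - f x) = t * t * dird v (dird w f) z2"
    using second_difference_mean_value[OF sub f t, of w v] tr by (auto simp: add.commute)
  have "x + t *\<^sub>R w + t *\<^sub>R v = x + t *\<^sub>R v + t *\<^sub>R w" by simp
  with z1(2) z2(2) have "t * t * dird w (dird v f) z1 = t * t * dird v (dird w f) z2"
    by (simp add: algebra_simps)
  then have "dird w (dird v f) z1 = dird v (dird w f) z2" using t by simp
  moreover have "\<bar>dird v (dird w f) z2 - dird v (dird w f) x\<bar> < \<epsilon>"
    using r1(2)[of z2] z2(1) by (auto simp: r_def)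
  moreover have "\<bar>dird w (dird v f) z1 - dird w (dird v f) x\<bar> < \<epsilon>"
    using r2(2)[of z1] z1(1) by (auto simp: r_def)
  ultimately show False unfolding \<epsilon>_def by (simp add: abs_if split: if_splits)
qed

section \<open>Second-order jets and the estimate for graphs\<close>

text \<open>Value and first two derivatives at 0 along a line. The first derivative is required only
  near 0, because graph functions are controlled only near the origin, and the second only at 0;
  this is just enough for the product rule and the second derivative test.\<close>

definition jet2 :: "(real \<Rightarrow> real) \<Rightarrow> real \<Rightarrow> real \<Rightarrow> real \<Rightarrow> bool" where
  "jet2 f a b c \<longleftrightarrow> f 0 = a \<and>
     (\<exists>f'. (\<forall>\<^sub>F t in nhds 0. (f has_real_derivative f' t) (at t)) \<and> f' 0 = b \<and>
       (f' has_real_derivative c) (at 0))"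

named_theorems jet2_intros

text \<open>Closes a jet computation: the introduction rules build the triple of an expression by
  unification, and this rule leaves the three equations with the triple wanted.\<close>

lemma jet2_eq: "jet2 f a b c \<Longrightarrow> a = a' \<Longrightarrow> b = b' \<Longrightarrow> c = c' \<Longrightarrow> jet2 f a' b' c'"
  by simp

lemma jet2_const [jet2_intros]: "jet2 (\<lambda>t. k) k 0 0"
  unfolding jet2_def by (auto intro!: exI[of _ "\<lambda>_. 0"])

lemma jet2_id [jet2_intros]: "jet2 (\<lambda>t. t) 0 1 0"
  unfolding jet2_def by (auto intro!: exI[of _ "\<lambda>_. 1"] derivative_eq_intros)

lemma jet2_add [jet2_intros]:
  assumes "jet2 f a b c" "jet2 g a' b' c'"
  shows "jet2 (\<lambda>t. f t + g t) (a + a') (b + b') (c + c')"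
proof -
  obtain f' g' where *: "\<forall>\<^sub>F t in nhds 0. (f has_real_derivative f' t) (at t)"
      "\<forall>\<^sub>F t in nhds 0. (g has_real_derivative g' t) (at t)" "f' 0 = b" "g' 0 = b'"
      "(f' has_real_derivative c) (at 0)" "(g' has_real_derivative c') (at 0)"
    using assms unfolding jet2_def by blast
  have "\<forall>\<^sub>F t in nhds 0. ((\<lambda>t. f t + g t) has_real_derivative f' t + g' t) (at t)"
    using *(1,2) by eventually_elim (rule DERIV_add)
  then show ?thesis using assms * unfolding jet2_def
    by (intro conjI exI[of _ "\<lambda>t. f' t + g' t"]) (auto intro: DERIV_add)
qed

lemma jet2_mult [jet2_intros]:
  assumes "jet2 f a b c" "jet2 g a' b' c'"
  shows "jet2 (\<lambda>t. f t * g t) (a * a') (b * a' + a * b') (c * a' + 2 * b * b' + a * c')"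
proof -
  obtain f' g' where *: "\<forall>\<^sub>F t in nhds 0. (f has_real_derivative f' t) (at t)"
      "\<forall>\<^sub>F t in nhds 0. (g has_real_derivative g' t) (at t)" "f' 0 = b" "g' 0 = b'"
      "(f' has_real_derivative c) (at 0)" "(g' has_real_derivative c') (at 0)"
    using assms unfolding jet2_def by blast
  have f: "(f has_real_derivative f' 0) (at 0)" and g: "(g has_real_derivative g' 0) (at 0)"
    using *(1,2) eventually_nhds_x_imp_x by fast+
  have "\<forall>\<^sub>F t in nhds 0. ((\<lambda>t. f t * g t) has_real_derivative f' t * g t + f t * g' t) (at t)"
    using *(1,2) by eventually_elim (auto intro!: derivative_eq_intros)
  moreover have "((\<lambda>t. f' t * g t + f t * g' t) has_real_derivative c * a' + 2 * b * b' + a * c') (at 0)"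
    using *(3-6) f g assms unfolding jet2_def by (auto intro!: derivative_eq_intros)
  ultimately show ?thesis using assms * unfolding jet2_def
    by (intro conjI exI[of _ "\<lambda>t. f' t * g t + f t * g' t"]) auto
qed

lemma jet2_diff [jet2_intros]:
  assumes "jet2 f a b c" "jet2 g a' b' c'"
  shows "jet2 (\<lambda>t. f t - g t) (a - a') (b - b') (c - c')"
proof -
  have "jet2 (\<lambda>t. f t + (- 1) * g t) (a - a') (b - b') (c - c')"
    by (rule jet2_eq, (rule jet2_intros assms)+) simp_all
  then show ?thesis by simp
qed

lemma jet2_sum [jet2_intros]:
  assumes "\<And>i. i \<in> I \<Longrightarrow> jet2 (\<lambda>t. f i t) (a i) (b i) (c i)"
  shows "jet2 (\<lambda>t. \<Sum>i\<in>I. f i t) (\<Sum>i\<in>I. a i) (\<Sum>i\<in>I. b i) (\<Sum>i\<in>I. c i)"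
  using assms
  by (induction I rule: infinite_finite_induct) (auto intro!: jet2_intros)

lemma eventually_line_in_open:
  fixes S :: "'a::real_normed_vector set"
  assumes "open S" "0 \<in> S"
  shows "\<forall>\<^sub>F t in nhds 0. t *\<^sub>R v \<in> S"
proof -
  have "open ((\<lambda>t. t *\<^sub>R v) -` S)"
    by (intro open_vimage assms(1) continuous_intros)
  then show ?thesis unfolding eventually_nhds
    using assms(2) by (intro exI[of _ "(\<lambda>t. t *\<^sub>R v) -` S"]) auto
qed

lemma jet2_smooth:
  assumes S: "open S" "0 \<in> S" and f: "smooth_on f S"
  shows "jet2 (\<lambda>t. f (t *\<^sub>R v)) (f 0) (dird v f 0) (dird v (dird v f) 0)"
proof -
  note ev = eventually_line_in_open[OF S, of v]
  have D: "((\<lambda>t. g (t *\<^sub>R v)) has_real_derivative dird v g (t *\<^sub>R v)) (at t)"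
    if "t *\<^sub>R v \<in> S" "smooth_on g S" for g :: "'a \<Rightarrow> real" and t
    using dird_line[of g 0 t v] smooth_on_differentiable[OF that(2,1)] by simp
  show ?thesis
    unfolding jet2_def using ev D[OF _ f] D[OF _ smooth_on_dird[OF f], of 0] S(2)
    by (intro conjI exI[of _ "\<lambda>t. dird v f (t *\<^sub>R v)"]) (auto elim: eventually_mono)
qed

text \<open>Used to differentiate an equation: applied to the residual of the graph equation along a
  line, it yields the equation at the origin together with its first and second derivatives.\<close>

lemma jet2_eventually_zero:
  assumes "jet2 f a b c" "\<forall>\<^sub>F t in nhds 0. f t = 0"
  shows "a = 0" "b = 0" "c = 0"
proof -
  obtain f' where *: "\<forall>\<^sub>F t in nhds 0. (f has_real_derivative f' t) (at t)" "f' 0 = b"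
      "(f' has_real_derivative c) (at 0)" "f 0 = a"
    using assms(1) unfolding jet2_def by blast
  \<comment> \<open>For t near 0 the function vanishes on a whole neighbourhood of t, hence so does
    its derivative at t.\<close>
  have z: "\<forall>\<^sub>F t in nhds 0. f' t = 0"
    using *(1) iffD2[OF eventually_eventually assms(2)]
  proof eventually_elim
    case (elim t)
    have "((\<lambda>t. 0) has_real_derivative f' t) (at t)"
      using elim(1) DERIV_cong_ev[of t t f "\<lambda>t. 0" "f' t" "f' t"] elim(2) by simp
    then show ?case using DERIV_unique DERIV_const by blast
  qed
  show "a = 0" using eventually_nhds_x_imp_x[OF assms(2)] * by simp
  show "b = 0" using eventually_nhds_x_imp_x[OF z] * by simp
  have "((\<lambda>t. 0) has_real_derivative c) (at 0)"
    using *(3) DERIV_cong_ev[of 0 0 f' "\<lambda>t. 0" c c] z by simp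
  then show "c = 0" using DERIV_unique DERIV_const by blast
qed

text \<open>If the second derivative were negative, the first derivative, which is 0 at 0, would be
  negative just to the right, and the mean value theorem would make the function negative
  there.\<close>

lemma jet2_local_min:
  assumes "jet2 f 0 b c" "\<forall>\<^sub>F t in nhds 0. 0 \<le> f t"
  shows "b = 0" "0 \<le> c"
proof -
  obtain f' where *: "\<forall>\<^sub>F t in nhds 0. (f has_real_derivative f' t) (at t)" "f' 0 = b"
      "(f' has_real_derivative c) (at 0)" "f 0 = 0"
    using assms(1) unfolding jet2_def by blast
  obtain d where d: "d > 0" "\<And>t. \<bar>t\<bar> < d \<Longrightarrow> (f has_real_derivative f' t) (at t) \<and> 0 \<le> f t"
    using eventually_conj[OF *(1) assms(2)] unfolding eventually_nhds_metric by (auto simp: dist_real_def)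
  show b: "b = 0"
    using DERIV_local_min[of f "f' 0" 0 d] d *(2,4) by auto
  show "0 \<le> c"
  proof (rule ccontr)
    assume "\<not> 0 \<le> c"
    then obtain e where e: "e > 0" "\<And>h. 0 < h \<Longrightarrow> h < e \<Longrightarrow> f' h < 0"
      using DERIV_neg_dec_right[OF *(3)] *(2) b by auto
    define h where "h = min d e / 2"
    have h: "0 < h" "h < d" "h < e" using d(1) e(1) by (auto simp: h_def min_def)
    have "(f has_real_derivative f' x) (at x)" if "0 \<le> x" "x \<le> h" for x
      using d(2)[of x] that h by auto
    from MVT2[OF h(1) this] obtain z where z: "0 < z" "z < h" "f h - f 0 = (h - 0) * f' z"
      by blast
    have "f h < 0" using z e(2)[of z] h *(4) by (simp add: mult_pos_neg)
    then show False using d(2)[of h] h by auto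
  qed
qed

text \<open>Agreement to second order at \<open>0\<close> makes the polynomial a substitute for \<open>sqrt\<close> in the second
  derivative test, where a lower bound of the area element has the right sign.\<close>

lemma sqrt_one_plus_lower:
  fixes s :: real
  assumes "0 \<le> s"
  shows "1 + s / 2 - s * s / 8 \<le> sqrt (1 + s)"
proof (cases "s \<le> 8")
  case True
  have "(1 + s) - (1 + s / 2 - s * s / 8)\<^sup>2 = s * s * s * (8 - s) / 64"
    by (simp add: power2_eq_square field_simps)
  moreover have "0 \<le> s * s * s * (8 - s) / 64" using assms True by simp
  ultimately show ?thesis by (intro real_le_rsqrt) linarith
next
  case False
  then have "s * 8 \<le> s * s" by (intro mult_left_mono) auto
  then have "1 + s / 2 - s * s / 8 \<le> 0" using False by linarith
  also have "0 \<le> sqrt (1 + s)" using assms by simp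
  finally show ?thesis .
qed

text \<open>The pairs \<open>(e, en)\<close>, \<open>(V, Vn)\<close>, \<open>(c, cn)\<close> are the tangential and normal components, at the maximum
  point \<open>p\<close>, of \<open>e\<^sub>n\<^sub>+\<^sub>1\<close>, \<open>V\<close> and \<open>p - x\<^sub>0\<close>; \<open>M\<close> is the maximum, attained in the direction \<open>\<xi>\<close>, and
  \<open>\<sigma> \<kappa>\<close> is the eigenvalue of the Hessian of \<open>u\<close> for \<open>\<xi>\<close>.\<close>

lemma graph_interior_estimate:
  fixes u :: "real^'n \<Rightarrow> real" and e V c \<xi> :: "real^'n"
  defines "D i \<equiv> dird (axis i 1)"
  defines "s y \<equiv> \<Sum>i\<in>UNIV. D i u y * D i u y"
  assumes B: "open B" "0 \<in> B" and u: "smooth_on u B" and u0: "u 0 = 0" "\<And>v. dird v u 0 = 0"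
    and pde: "\<And>y. y \<in> B \<Longrightarrow> (\<Sum>i\<in>UNIV. D i (D i u) y) * (1 + s y)
        - (\<Sum>i\<in>UNIV. \<Sum>j\<in>UNIV. D i u y * D j u y * D i (D j u) y)
        = (en - (\<Sum>i\<in>UNIV. e $ i * D i u y)) * (1 + s y)"
    and \<sigma>: "\<sigma> * \<sigma> = (1::real)" and \<xi>: "norm \<xi> = 1" and \<kappa>: "0 < \<kappa>"
    and eig: "\<And>v. dird v (dird \<xi> u) 0 = \<sigma> * \<kappa> * (\<xi> \<bullet> v)"
    and \<eta>0: "\<eta>0 = R\<^sup>2 - (c \<bullet> c + cn * cn)" "0 < \<eta>0" and R: "0 < R"
    and a: "0 < a" "a < Vn" "Vn - a \<le> 1" and V: "norm V \<le> 1"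
    and ce: "en * cn + e \<bullet> c \<le> R"
    and M: "M * (Vn - a) = \<eta>0 * \<kappa>"
    and ineq: "\<And>y. y \<in> B \<Longrightarrow>
        \<sigma> * (R\<^sup>2 - ((c + y) \<bullet> (c + y) + (cn + u y) * (cn + u y))) * dird \<xi> (dird \<xi> u) y
        \<le> M * (Vn - (\<Sum>i\<in>UNIV. V $ i * D i u y) - a * sqrt (1 + s y))
           * (1 + dird \<xi> u y * dird \<xi> u y)"
  shows "(\<eta>0 * \<kappa>)\<^sup>2 \<le> 2 / a * R\<^sup>2 * (8 / a + 8 + 2 * real CARD('n) + 2 * R)"
proof -
  define A where "A i j = D i (D j u) 0" for i j
  define f where "f = dird \<xi> (dird \<xi> u)"
  have sD: "smooth_on (D i g) B" if "smooth_on g B" for i g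
    unfolding D_def using that by (rule smooth_on_dird)
  have sd: "smooth_on (dird v g) B" if "smooth_on g B" for v and g :: "real^'n \<Rightarrow> real"
    using that by (rule smooth_on_dird)
  have com0: "dird v (dird w g) y = dird w (dird v g) y" if "y \<in> B" "smooth_on g B"
    for v w y and g :: "real^'n \<Rightarrow> real"
    using dird_commute[OF B(1) that] .
  have com: "dird v (dird v (dird w g)) 0 = dird w (dird v (dird v g)) 0" if "smooth_on g B"
    for v w and g :: "real^'n \<Rightarrow> real"
  proof -
    have "dird v (dird v (dird w g)) 0 = dird v (dird w (dird v g)) 0"
      by (rule dird_cong[OF B]) (rule com0[OF _ that])
    also have "\<dots> = dird w (dird v (dird v g)) 0"
      by (rule com0[OF B(2) smooth_on_dird[OF that]])
    finally show ?thesis .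
  qed
  have Dcong: "D i g 0 = D i h 0" if "\<And>y. y \<in> B \<Longrightarrow> g y = h y" for i and g h :: "real^'n \<Rightarrow> real"
    unfolding D_def by (rule dird_cong[OF B that])
  have Asym: "A i j = A j i" for i j
    unfolding A_def D_def using com0[OF B(2) u] .
  have Jf: "jet2 (\<lambda>t. g (t *\<^sub>R v)) (g 0) (dird v g 0) (dird v (dird v g) 0)"
    if "smooth_on g B" for v and g :: "real^'n \<Rightarrow> real"
    using jet2_smooth[OF B that] .
  have Ju: "jet2 (\<lambda>t. u (t *\<^sub>R v)) 0 0 (dird v (dird v u) 0)" for v
    using Jf[OF u, of v] u0 by simp
  have JDu: "jet2 (\<lambda>t. D i u (t *\<^sub>R v)) 0 (dird v (D i u) 0) (dird v (dird v (D i u)) 0)" for v i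
    using Jf[OF sD[OF u], of i v] u0 by (simp add: D_def)
  have JDDu: "jet2 (\<lambda>t. D i (D j u) (t *\<^sub>R v)) (A i j) (dird v (D i (D j u)) 0) (dird v (dird v (D i (D j u))) 0)"
    for v i j
    using Jf[OF sD[OF sD[OF u]]] by (simp add: A_def)
  \<comment> \<open>The residual of the graph equation. Since Du = 0 at the origin, a product of two
    first derivatives contributes to its jet only when both factors are differentiated once.\<close>
  define P where "P y = (\<Sum>i\<in>UNIV. D i (D i u) y) * (1 + s y)
        - (\<Sum>i\<in>UNIV. \<Sum>j\<in>UNIV. D i u y * D j u y * D i (D j u) y)
        - (en - (\<Sum>i\<in>UNIV. e $ i * D i u y)) * (1 + s y)" for y
  define L where "L v = (\<Sum>i\<in>UNIV. dird v (D i (D i u)) 0)" for v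
  define p where "p v i = dird v (D i u) 0" for v i
  have Js: "jet2 (\<lambda>t. s (t *\<^sub>R v)) 0 0 (2 * (\<Sum>i\<in>UNIV. p v i * p v i))" for v
    unfolding s_def by (rule jet2_eq, (rule JDu jet2_intros)+)
      (simp_all add: p_def sum_distrib_left mult.assoc)
  have Jee: "jet2 (\<lambda>t. \<Sum>i\<in>UNIV. e $ i * D i u (t *\<^sub>R v)) 0 (\<Sum>i\<in>UNIV. e $ i * p v i)
      (\<Sum>i\<in>UNIV. e $ i * dird v (dird v (D i u)) 0)" for v
    by (rule jet2_eq, (rule JDu jet2_intros)+) (simp_all add: p_def)
  have JL: "jet2 (\<lambda>t. \<Sum>i\<in>UNIV. D i (D i u) (t *\<^sub>R v)) (\<Sum>i\<in>UNIV. A i i) (L v)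
      (\<Sum>i\<in>UNIV. dird v (dird v (D i (D i u))) 0)" for v
    by (rule jet2_eq, (rule JDDu jet2_intros)+) (simp_all add: L_def)
  have JQ: "jet2 (\<lambda>t. \<Sum>i\<in>UNIV. \<Sum>j\<in>UNIV. D i u (t *\<^sub>R v) * D j u (t *\<^sub>R v) * D i (D j u) (t *\<^sub>R v))
      0 0 (\<Sum>i\<in>UNIV. \<Sum>j\<in>UNIV. 2 * p v i * p v j * A i j)" for v
    by (rule jet2_eq, (rule JDu JDDu jet2_intros)+) (simp_all add: p_def)
  have JP: "jet2 (\<lambda>t. P (t *\<^sub>R v)) ((\<Sum>i\<in>UNIV. A i i) - en)
     (L v + (\<Sum>i\<in>UNIV. e $ i * p v i))
     ((\<Sum>i\<in>UNIV. dird v (dird v (D i (D i u))) 0)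
       + (\<Sum>i\<in>UNIV. A i i) * (2 * (\<Sum>i\<in>UNIV. p v i * p v i))
       - (\<Sum>i\<in>UNIV. \<Sum>j\<in>UNIV. 2 * p v i * p v j * A i j)
       + (\<Sum>i\<in>UNIV. e $ i * dird v (dird v (D i u)) 0)
       - en * (2 * (\<Sum>i\<in>UNIV. p v i * p v i)))" for v
    unfolding P_def by (rule jet2_eq, (rule Js Jee JL JQ jet2_intros)+) (simp_all add: algebra_simps)
  have P0: "\<forall>\<^sub>F t in nhds 0. P (t *\<^sub>R v) = 0" for v
    using eventually_line_in_open[OF B, of v] by eventually_elim (simp add: P_def pde)
  have lap: "(\<Sum>i\<in>UNIV. A i i) = en"
    using jet2_eventually_zero(1)[OF JP P0] by simp
  have lap1: "L v = - (\<Sum>i\<in>UNIV. e $ i * p v i)" for v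
    using jet2_eventually_zero(2)[OF JP P0, of v] by simp
  have p_eig: "p \<xi> i = \<sigma> * \<kappa> * \<xi> $ i" for i
    using eig[of "axis i 1"] com0[OF B(2) u, of \<xi> "axis i 1"] by (simp add: p_def D_def inner_axis)
  have p_axis: "p (axis k 1) i = A k i" for k i
    by (simp add: p_def A_def D_def)
  have p_eig': "D i (dird \<xi> u) 0 = \<sigma> * \<kappa> * \<xi> $ i" for i
    using eig[of "axis i 1"] by (simp add: D_def inner_axis)
  have \<xi>sum: "(\<Sum>i\<in>UNIV. \<xi> $ i * \<xi> $ i) = 1"
    using \<xi> by (simp add: norm_eq_1 inner_vec_def)
  have pA: "p v j = (\<Sum>i\<in>UNIV. v $ i * A i j)" for v j
    unfolding p_def A_def D_def
    by (rule dird_axis_expansion) (rule smooth_on_differentiable[OF smooth_on_dird[OF u] B(2)])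
  have f0: "f 0 = \<sigma> * \<kappa>"
    using eig[of \<xi>] \<xi> by (simp add: f_def norm_eq_1)
  have pp: "(\<Sum>i\<in>UNIV. p \<xi> i * p \<xi> i) = \<kappa> * \<kappa>"
  proof -
    have "(\<Sum>i\<in>UNIV. p \<xi> i * p \<xi> i) = (\<sigma> * \<sigma>) * (\<kappa> * \<kappa>) * (\<Sum>i\<in>UNIV. \<xi> $ i * \<xi> $ i)"
      unfolding p_eig sum_distrib_left by (intro sum.cong refl) (simp add: algebra_simps)
    then show ?thesis using \<sigma> \<xi>sum by simp
  qed
  have ppA: "(\<Sum>i\<in>UNIV. \<Sum>j\<in>UNIV. 2 * p \<xi> i * p \<xi> j * A i j) = 2 * \<sigma> * \<kappa> * \<kappa> * \<kappa>"
  proof -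
    have "(\<Sum>i\<in>UNIV. \<Sum>j\<in>UNIV. 2 * p \<xi> i * p \<xi> j * A i j)
        = (\<Sum>j\<in>UNIV. 2 * \<sigma> * \<kappa> * p \<xi> j * (\<Sum>i\<in>UNIV. \<xi> $ i * A i j))"
      unfolding sum_distrib_left
      by (subst sum.swap) (intro sum.cong refl, simp add: p_eig[of _] algebra_simps)
    also have "\<dots> = 2 * \<sigma> * \<kappa> * (\<Sum>i\<in>UNIV. p \<xi> i * p \<xi> i)"
      unfolding pA[symmetric] sum_distrib_left by (simp add: algebra_simps)
    finally show ?thesis using pp by simp
  qed
  define b where "b i = D i f 0" for i
  define q where "q i = D i (D i f) 0" for i
  \<comment> \<open>The twice differentiated equation in direction \<open>\<xi>\<close>. The two
    terms with the trace of \<open>A\<close> cancel because that trace is \<open>en\<close>; the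
    cubic term comes from the quadratic gradient term of the equation.\<close>
  have lap2: "(\<Sum>i\<in>UNIV. q i) = 2 * \<sigma> * \<kappa> * \<kappa> * \<kappa> - (\<Sum>i\<in>UNIV. e $ i * b i)"
  proof -
    have 1: "dird \<xi> (dird \<xi> (D i (D i u))) 0 = q i" for i
    proof -
      have "dird \<xi> (dird \<xi> (D i g)) y = D i (dird \<xi> (dird \<xi> g)) y" if "y \<in> B" "smooth_on g B" for g y
      proof -
        have "dird \<xi> (dird \<xi> (D i g)) y = dird \<xi> (D i (dird \<xi> g)) y"
          unfolding D_def by (rule dird_cong[OF B(1) that(1)]) (rule com0[OF _ that(2)])
        also have "\<dots> = D i (dird \<xi> (dird \<xi> g)) y"
          unfolding D_def by (rule com0[OF that(1) smooth_on_dird[OF that(2)]])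
        finally show ?thesis .
      qed
      note c1 = this
      have "dird \<xi> (dird \<xi> (D i (D i u))) 0 = D i (dird \<xi> (dird \<xi> (D i u))) 0"
        by (rule c1[OF B(2) sD[OF u]])
      also have "\<dots> = D i (D i f) 0"
        unfolding f_def by (rule Dcong, rule c1[OF _ u])
      finally show ?thesis by (simp add: q_def)
    qed
    have 2: "dird \<xi> (dird \<xi> (D i u)) 0 = b i" for i
      using com[OF u, of \<xi> "axis i 1"] by (simp add: b_def f_def D_def)
    show ?thesis
      using jet2_eventually_zero(3)[OF JP P0, of \<xi>] unfolding 1 2 ppA lap pp by simp
  qed
  \<comment> \<open>At the origin the graph metric is Euclidean, so \<open>S\<close> is |A|^2 there.
    Below, \<open>G\<close> and \<open>T\<close> collect the first and the pure second derivatives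
    along the axes of the inner product of V with Du.\<close>
  define S where "S = (\<Sum>i\<in>UNIV. \<Sum>j\<in>UNIV. A i j * A i j)"
  define \<eta> where "\<eta> y = R\<^sup>2 - ((c + y) \<bullet> (c + y) + (cn + u y) * (cn + u y))" for y
  define T where "T i = (\<Sum>k\<in>UNIV. V $ k * dird (axis i 1) (dird (axis i 1) (D k u)) 0)" for i
  define G where "G i = (\<Sum>k\<in>UNIV. V $ k * A i k)" for i
  have J\<eta>: "jet2 (\<lambda>t. \<eta> (t *\<^sub>R axis i 1)) \<eta>0 (- 2 * c $ i) (- 2 - 2 * cn * A i i)" for i
  proof -
    have *: "(c + t *\<^sub>R axis i 1) \<bullet> (c + t *\<^sub>R axis i 1) = c \<bullet> c + 2 * t * c $ i + t * t" for t
      by (simp add: inner_add_left inner_add_right inner_axis inner_axis' algebra_simps)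
    show ?thesis unfolding \<eta>_def * \<eta>0(1)
      by (rule jet2_eq, (rule Ju jet2_intros)+) (simp_all add: A_def D_def)
  qed
  \<comment> \<open>Right side minus left side of \<open>ineq\<close>, with the square root replaced
    by its polynomial minorant. Thus \<open>F\<close> is nonnegative near 0 and vanishes at 0, and
    its jets follow from sums and products alone.\<close>
  define F where "F y = M * (Vn - (\<Sum>i\<in>UNIV. V $ i * D i u y) - a * (1 + s y * (1 / 2) - s y * s y * (1 / 8)))
      * (1 + dird \<xi> u y * dird \<xi> u y) - \<sigma> * (\<eta> y * f y)" for y
  have JV: "jet2 (\<lambda>t. \<Sum>k\<in>UNIV. V $ k * D k u (t *\<^sub>R axis i 1)) 0 (G i) (T i)" for i
    by (rule jet2_eq, (rule JDu jet2_intros)+) (simp_all add: p_axis[unfolded p_def] G_def T_def)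
  have Jxi: "jet2 (\<lambda>t. dird \<xi> u (t *\<^sub>R axis i 1)) 0 (\<sigma> * \<kappa> * \<xi> $ i) (dird (axis i 1) (dird (axis i 1) (dird \<xi> u)) 0)" for i
    using Jf[OF sd[OF u], of \<xi> "axis i 1"] p_eig'[of i] u0 by (simp add: D_def)
  have Jff: "jet2 (\<lambda>t. f (t *\<^sub>R axis i 1)) (\<sigma> * \<kappa>) (b i) (q i)" for i
    using Jf[OF sd[OF sd[OF u]], of \<xi> \<xi> "axis i 1"] f0 by (simp add: f_def b_def q_def D_def)
  have JF: "jet2 (\<lambda>t. F (t *\<^sub>R axis i 1)) 0 (- M * G i - \<kappa> * (- 2 * c $ i) - \<sigma> * \<eta>0 * b i)
     (M * (Vn - a) * (2 * \<kappa> * \<kappa> * (\<xi> $ i * \<xi> $ i)) - M * T i - M * a * (\<Sum>k\<in>UNIV. A i k * A i k)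
       - \<kappa> * (- 2 - 2 * cn * A i i) - 2 * \<sigma> * (- 2 * c $ i) * b i - \<sigma> * \<eta>0 * q i)" for i
  proof -
    have \<sigma>': "\<sigma> * (x * (\<sigma> * y)) = x * y" "\<sigma> * x * (\<sigma> * y) = x * y" for x y
      using arg_cong[OF \<sigma>, of "\<lambda>r. r * x * y"] by (simp_all add: algebra_simps)
    have J: "jet2 (\<lambda>t. F (t *\<^sub>R axis i 1))
      (M * (Vn - a) - \<sigma> * (\<eta>0 * (\<sigma> * \<kappa>))) (- M * G i - \<sigma> * (- 2 * c $ i * (\<sigma> * \<kappa>) + \<eta>0 * b i))
      (M * (- T i - a * (\<Sum>k\<in>UNIV. A i k * A i k)) + M * (Vn - a) * (2 * ((\<sigma> * (\<kappa> * \<xi> $ i)) * (\<sigma> * (\<kappa> * \<xi> $ i))))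
       - \<sigma> * ((- 2 - 2 * cn * A i i) * (\<sigma> * \<kappa>) + 2 * (- 2 * c $ i) * b i + \<eta>0 * q i))"
      unfolding F_def
      by (rule jet2_eq, (rule JV Js Jxi Jff J\<eta> jet2_intros)+) (simp_all add: p_axis algebra_simps)
    show ?thesis
    proof (rule jet2_eq[OF J])
      show "M * (Vn - a) - \<sigma> * (\<eta>0 * (\<sigma> * \<kappa>)) = 0"
        unfolding \<sigma>' M by simp
    next
      have "\<sigma> * (- 2 * c $ i * (\<sigma> * \<kappa>) + \<eta>0 * b i) = - 2 * c $ i * \<kappa> + \<sigma> * \<eta>0 * b i"
        unfolding distrib_left \<sigma>' by simp
      then show "- M * G i - \<sigma> * (- 2 * c $ i * (\<sigma> * \<kappa>) + \<eta>0 * b i) = - M * G i - \<kappa> * (- 2 * c $ i) - \<sigma> * \<eta>0 * b i"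
        by simp
    next
      have e1: "\<sigma> * ((- 2 - 2 * cn * A i i) * (\<sigma> * \<kappa>) + 2 * (- 2 * c $ i) * b i + \<eta>0 * q i)
        = (- 2 - 2 * cn * A i i) * \<kappa> + \<sigma> * (2 * (- 2 * c $ i) * b i) + \<sigma> * (\<eta>0 * q i)"
        unfolding distrib_left \<sigma>' by simp
      have e2: "\<sigma> * (\<kappa> * \<xi> $ i) * (\<sigma> * (\<kappa> * \<xi> $ i)) = \<kappa> * \<xi> $ i * (\<kappa> * \<xi> $ i)"
        by (rule \<sigma>')
      show "M * (- T i - a * (\<Sum>k\<in>UNIV. A i k * A i k)) + M * (Vn - a) * (2 * ((\<sigma> * (\<kappa> * \<xi> $ i)) * (\<sigma> * (\<kappa> * \<xi> $ i))))
       - \<sigma> * ((- 2 - 2 * cn * A i i) * (\<sigma> * \<kappa>) + 2 * (- 2 * c $ i) * b i + \<eta>0 * q i)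
       = M * (Vn - a) * (2 * \<kappa> * \<kappa> * (\<xi> $ i * \<xi> $ i)) - M * T i - M * a * (\<Sum>k\<in>UNIV. A i k * A i k)
       - \<kappa> * (- 2 - 2 * cn * A i i) - 2 * \<sigma> * (- 2 * c $ i) * b i - \<sigma> * \<eta>0 * q i"
        unfolding e1 e2 by (simp add: algebra_simps)
    qed
  qed
  have F0: "\<forall>\<^sub>F t in nhds 0. 0 \<le> F (t *\<^sub>R axis i 1)" for i
    using eventually_line_in_open[OF B, of "axis i 1"]
  proof eventually_elim
    case (elim t)
    let ?y = "t *\<^sub>R axis i 1"
    \<comment> \<open>The sign matters: the minorant of the square root enlarges the right side of
      \<open>ineq\<close> only because \<open>M\<close> and \<open>a\<close> are positive.\<close>
    have Mp: "M > 0" using M a \<eta>0(2) \<kappa> by (metis diff_gt_0_iff_gt zero_less_mult_iff zero_less_mult_pos2)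
    have s0: "0 \<le> s ?y" unfolding s_def by (intro sum_nonneg) simp
    have "a * (1 + s ?y / 2 - s ?y * s ?y / 8) \<le> a * sqrt (1 + s ?y)"
      using sqrt_one_plus_lower[OF s0] a(1) by (simp only: mult_le_cancel_left_pos)
    then have "M * (Vn - (\<Sum>i\<in>UNIV. V $ i * D i u ?y) - a * sqrt (1 + s ?y)) * (1 + dird \<xi> u ?y * dird \<xi> u ?y)
      \<le> M * (Vn - (\<Sum>i\<in>UNIV. V $ i * D i u ?y) - a * (1 + s ?y / 2 - s ?y * s ?y / 8)) * (1 + dird \<xi> u ?y * dird \<xi> u ?y)"
      using Mp by (intro mult_right_mono mult_left_mono) (auto intro: add_nonneg_nonneg)
    with ineq[OF elim] show ?case by (simp add: F_def \<eta>_def f_def mult.assoc)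
  qed
  \<comment> \<open>The gradient of \<open>F\<close> vanishes. This expresses the third derivatives
    \<open>b\<close> through second derivatives of u and the gradient of \<eta>.\<close>
  have first: "\<sigma> * \<eta>0 * b i = - M * G i + 2 * \<kappa> * c $ i" for i
    using jet2_local_min(1)[OF JF F0, of i] by simp
  \<comment> \<open>The second derivative test summed over the axes. The term with
    \<open>4 * \<sigma>\<close> is the cross term of the gradients of \<eta> and
    \<open>f\<close>.\<close>
  have second: "0 \<le> 2 * M * (Vn - a) * \<kappa> * \<kappa> - M * (\<Sum>i\<in>UNIV. T i) - M * a * S + \<kappa> * (2 * CARD('n) + 2 * cn * en)
      + 4 * \<sigma> * (\<Sum>i\<in>UNIV. c $ i * b i) - \<sigma> * \<eta>0 * (\<Sum>i\<in>UNIV. q i)"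
  proof -
    have "0 \<le> (\<Sum>i\<in>UNIV. (M * (Vn - a) * (2 * \<kappa> * \<kappa> * (\<xi> $ i * \<xi> $ i)) - M * T i - M * a * (\<Sum>k\<in>UNIV. A i k * A i k)
       - \<kappa> * (- 2 - 2 * cn * A i i) - 2 * \<sigma> * (- 2 * c $ i) * b i - \<sigma> * \<eta>0 * q i))"
      using jet2_local_min(2)[OF JF F0] by (intro sum_nonneg) blast
    also have "\<dots> = M * (Vn - a) * (2 * \<kappa> * \<kappa> * (\<Sum>i\<in>UNIV. \<xi> $ i * \<xi> $ i)) - M * (\<Sum>i\<in>UNIV. T i) - M * a * S
       - \<kappa> * (- 2 * CARD('n) - 2 * cn * (\<Sum>i\<in>UNIV. A i i)) - 2 * \<sigma> * (- 2 * (\<Sum>i\<in>UNIV. c $ i * b i)) - \<sigma> * \<eta>0 * (\<Sum>i\<in>UNIV. q i)"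
      unfolding S_def sum_distrib_left sum_subtractf sum.distrib by (simp add: sum_subtractf sum_negf sum_distrib_left mult.assoc algebra_simps)
    finally show ?thesis unfolding lap \<xi>sum by (simp add: algebra_simps)
  qed
  \<comment> \<open>Commuting derivatives turns the Laplacian of the inner product of V with Du into
    derivatives of the Laplacian of u, which the once differentiated equation evaluates.\<close>
  have sumT: "(\<Sum>i\<in>UNIV. T i) = - (\<Sum>j\<in>UNIV. e $ j * G j)"
  proof -
    have "(\<Sum>i\<in>UNIV. T i) = (\<Sum>k\<in>UNIV. V $ k * L (axis k 1))"
      unfolding T_def L_def sum_distrib_left
      by (subst sum.swap) (simp add: D_def com[OF u])
    also have "\<dots> = - (\<Sum>j\<in>UNIV. e $ j * G j)"
      unfolding lap1 p_axis G_def sum_distrib_left sum_negf[symmetric] mult_minus_right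
      by (subst sum.swap) (intro sum.cong refl, simp add: Asym algebra_simps)
    finally show ?thesis .
  qed
  have eb_eq: "\<sigma> * \<eta>0 * (\<Sum>i\<in>UNIV. e $ i * b i) = - M * (\<Sum>j\<in>UNIV. e $ j * G j) + 2 * \<kappa> * (e \<bullet> c)"
  proof -
    have "\<sigma> * \<eta>0 * (\<Sum>i\<in>UNIV. e $ i * b i) = (\<Sum>i\<in>UNIV. e $ i * (\<sigma> * \<eta>0 * b i))"
      unfolding sum_distrib_left by (simp add: algebra_simps)
    then show ?thesis unfolding first
      by (simp add: sum.distrib sum_distrib_left inner_vec_def algebra_simps sum_negf sum_subtractf)
  qed
  have cb_eq: "\<sigma> * \<eta>0 * (\<Sum>i\<in>UNIV. c $ i * b i) = - M * (\<Sum>j\<in>UNIV. c $ j * G j) + 2 * \<kappa> * (c \<bullet> c)"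
  proof -
    have "\<sigma> * \<eta>0 * (\<Sum>i\<in>UNIV. c $ i * b i) = (\<Sum>i\<in>UNIV. c $ i * (\<sigma> * \<eta>0 * b i))"
      unfolding sum_distrib_left by (simp add: algebra_simps)
    then show ?thesis unfolding first
      by (simp add: sum.distrib sum_distrib_left inner_vec_def algebra_simps sum_negf sum_subtractf)
  qed
  define d where "d = Vn - a"
  define E where "E = (\<Sum>j\<in>UNIV. e $ j * G j)"
  define H where "H = (\<Sum>j\<in>UNIV. c $ j * G j)"
  define eb where "eb = (\<Sum>i\<in>UNIV. e $ i * b i)"
  define cb where "cb = (\<Sum>i\<in>UNIV. c $ i * b i)"
  define N where "N = 2 * real CARD('n) + 2 * (en * cn + e \<bullet> c)"
  have d: "0 < d" "d \<le> 1" using a by (auto simp: d_def)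
  \<comment> \<open>Two cancellations: the term 2 M d \<kappa>^2, from the squared length of the
    lifted direction, against the cubic term of \<open>lap2\<close>; and the drift term M E from
    \<open>sumT\<close> against the one in \<open>eb_eq\<close>. What remains besides |A|^2 comes
    from \<eta>.\<close>
  have 1: "M * a * S \<le> \<kappa> * N + 4 * \<sigma> * cb"
  proof -
    have "\<sigma> * \<eta>0 * (2 * \<sigma> * \<kappa> * \<kappa> * \<kappa> - eb) = (\<sigma> * \<sigma>) * (\<eta>0 * \<kappa>) * (2 * \<kappa> * \<kappa>) - \<sigma> * \<eta>0 * eb"
      by (simp add: algebra_simps)
    then have q: "\<sigma> * \<eta>0 * (\<Sum>i\<in>UNIV. q i) = 2 * M * d * \<kappa> * \<kappa> - \<sigma> * \<eta>0 * eb"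
      using \<sigma> M unfolding lap2 eb_def[symmetric] by (simp add: d_def)
    show ?thesis
      using second eb_eq unfolding q sumT d_def[symmetric] E_def[symmetric] eb_def[symmetric]
        cb_def[symmetric] N_def by (simp add: algebra_simps)
  qed
  \<comment> \<open>Multiplying by \<eta>0 d replaces M d by \<eta>0 \<kappa> and makes
    \<open>cb_eq\<close> applicable; the common factor \<kappa> then cancels.\<close>
  have 2: "a * (\<eta>0 * \<eta>0 * S) \<le> \<eta>0 * d * N - 4 * \<eta>0 * H + 8 * d * (c \<bullet> c)"
  proof -
    have "(\<eta>0 * d) * (M * a * S) \<le> (\<eta>0 * d) * (\<kappa> * N + 4 * \<sigma> * cb)"
      using 1 \<eta>0(2) d(1) by (intro mult_left_mono) auto
    also have "(\<eta>0 * d) * (M * a * S) = \<kappa> * (a * (\<eta>0 * \<eta>0 * S))"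
      using arg_cong[OF M, of "\<lambda>x. x * (\<eta>0 * a * S)"] by (simp add: d_def algebra_simps)
    also have "(\<eta>0 * d) * (\<kappa> * N + 4 * \<sigma> * cb) = \<eta>0 * d * \<kappa> * N + 4 * d * (\<sigma> * \<eta>0 * cb)"
      by (simp add: algebra_simps)
    also have "4 * d * (\<sigma> * \<eta>0 * cb) = - 4 * (M * d) * H + 8 * d * \<kappa> * (c \<bullet> c)"
      unfolding cb_eq[folded cb_def H_def] by (simp add: algebra_simps)
    also have "M * d = \<eta>0 * \<kappa>" using M by (simp add: d_def)
    finally have "\<kappa> * (a * (\<eta>0 * \<eta>0 * S)) \<le> \<kappa> * (\<eta>0 * d * N - 4 * \<eta>0 * H + 8 * d * (c \<bullet> c))"
      by (simp add: algebra_simps)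
    then show ?thesis using \<kappa> by simp
  qed
  have S0: "0 \<le> S" unfolding S_def by (intro sum_nonneg) simp
  have cc: "c \<bullet> c \<le> R\<^sup>2" and \<eta>R: "\<eta>0 \<le> R\<^sup>2" 
    using \<eta>0 zero_le_square[of cn] inner_ge_zero[of c] by linarith+
  have VV: "(\<Sum>k\<in>UNIV. (V $ k)\<^sup>2) \<le> 1"
    using V by (simp add: norm_eq_sqrt_inner inner_vec_def power2_eq_square)
  have HS: "\<bar>H\<bar> \<le> R * sqrt S"
  proof -
    have "(G i)\<^sup>2 \<le> (\<Sum>k\<in>UNIV. (A i k)\<^sup>2)" for i
    proof -
      have "(G i)\<^sup>2 \<le> (\<Sum>k\<in>UNIV. (V $ k)\<^sup>2) * (\<Sum>k\<in>UNIV. (A i k)\<^sup>2)"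
        unfolding G_def by (rule Cauchy_Schwarz_ineq_sum)
      also have "\<dots> \<le> 1 * (\<Sum>k\<in>UNIV. (A i k)\<^sup>2)"
        by (intro mult_right_mono VV sum_nonneg) simp
      finally show ?thesis by simp
    qed
    then have G2: "(\<Sum>i\<in>UNIV. (G i)\<^sup>2) \<le> S"
      unfolding S_def by (intro sum_mono) (simp add: power2_eq_square)
    have "H\<^sup>2 \<le> (\<Sum>i\<in>UNIV. (c $ i)\<^sup>2) * (\<Sum>i\<in>UNIV. (G i)\<^sup>2)"
      unfolding H_def by (rule Cauchy_Schwarz_ineq_sum)
    also have "\<dots> \<le> R\<^sup>2 * S"
      using cc G2 by (intro mult_mono) (auto simp: inner_vec_def power2_eq_square intro: sum_nonneg)
    also have "\<dots> = (R * sqrt S)\<^sup>2" using S0 by (simp add: power_mult_distrib)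
    finally have "\<bar>H\<bar> \<le> \<bar>R * sqrt S\<bar>" by (simp only: abs_le_square_iff)
    then show ?thesis using R S0 by simp
  qed
  \<comment> \<open>The Hessian maps the unit vector \<open>\<xi>\<close> to a vector of length
    \<kappa>, and its Frobenius norm dominates that length.\<close>
  have \<kappa>S: "\<kappa>\<^sup>2 \<le> S"
  proof -
    have "(p \<xi> j)\<^sup>2 \<le> (\<Sum>i\<in>UNIV. (A i j)\<^sup>2)" for j
    proof -
      have "(p \<xi> j)\<^sup>2 \<le> (\<Sum>i\<in>UNIV. (\<xi> $ i)\<^sup>2) * (\<Sum>i\<in>UNIV. (A i j)\<^sup>2)"
        unfolding pA by (rule Cauchy_Schwarz_ineq_sum)
      then show ?thesis using \<xi>sum by (simp add: power2_eq_square)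
    qed
    then have "(\<Sum>j\<in>UNIV. (p \<xi> j)\<^sup>2) \<le> (\<Sum>j\<in>UNIV. \<Sum>i\<in>UNIV. (A i j)\<^sup>2)"
      by (intro sum_mono)
    also have "\<dots> = S" unfolding S_def by (subst sum.swap) (simp add: power2_eq_square)
    finally show ?thesis using pp by (simp add: power2_eq_square)
  qed
  define z where "z = \<eta>0 * sqrt S"
  have z2: "z\<^sup>2 = \<eta>0 * \<eta>0 * S" using S0 by (simp add: z_def power_mult_distrib power2_eq_square)
  have "\<eta>0 * d * N \<le> R\<^sup>2 * (2 * real CARD('n) + 2 * R)"
  proof -
    have "\<eta>0 * d * N \<le> \<eta>0 * d * (2 * real CARD('n) + 2 * R)"
      using ce \<eta>0(2) d(1) by (intro mult_left_mono) (auto simp: N_def)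
    also have "\<dots> \<le> (R\<^sup>2 * 1) * (2 * real CARD('n) + 2 * R)"
      using \<eta>R \<eta>0(2) d R by (intro mult_right_mono mult_mono) auto
    finally show ?thesis by simp
  qed
  moreover have "- 4 * \<eta>0 * H \<le> 4 * R * z"
  proof -
    have "\<eta>0 * (- H) \<le> \<eta>0 * (R * sqrt S)" using HS \<eta>0(2) by (intro mult_left_mono) auto
    then show ?thesis by (simp add: z_def algebra_simps)
  qed
  moreover have "8 * d * (c \<bullet> c) \<le> 8 * 1 * R\<^sup>2"
    using d cc by (intro mult_mono) auto
  ultimately have 3: "a * z\<^sup>2 \<le> R\<^sup>2 * (2 * real CARD('n) + 2 * R) + 4 * R * z + 8 * R\<^sup>2"
    using 2 unfolding z2 by linarith
  \<comment> \<open>Completing a square absorbs the linear term into half of a z^2, at the cost of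
    the 8/a in the final constant. There the 8 comes from the gradient of \<eta>, and 2n + 2R from
    its drift Laplacian.\<close>
  have "4 * R * z \<le> a * z\<^sup>2 / 2 + 8 * R\<^sup>2 / a"
  proof -
    have "0 \<le> (a * z - 4 * R)\<^sup>2 / (2 * a)" using a(1) by simp
    also have "\<dots> = a * z\<^sup>2 / 2 + 8 * R\<^sup>2 / a - 4 * R * z"
      using a(1) by (simp add: power2_eq_square field_simps)
    finally show ?thesis by simp
  qed
  moreover have "R\<^sup>2 * (8 / a + 8 + 2 * real CARD('n) + 2 * R)
      = 8 * R\<^sup>2 / a + R\<^sup>2 * (2 * real CARD('n) + 2 * R) + 8 * R\<^sup>2"
    by (simp add: algebra_simps)
  ultimately have "a * z\<^sup>2 / 2 \<le> R\<^sup>2 * (8 / a + 8 + 2 * real CARD('n) + 2 * R)"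
    using 3 by linarith
  then have "z\<^sup>2 \<le> 2 / a * R\<^sup>2 * (8 / a + 8 + 2 * real CARD('n) + 2 * R)"
    using a(1) by (simp add: field_simps)
  moreover have "(\<eta>0 * \<kappa>)\<^sup>2 \<le> z\<^sup>2"
    unfolding z2 power_mult_distrib using \<kappa>S by (simp add: power2_eq_square mult_left_mono)
  ultimately show ?thesis by linarith
qed

section \<open>Hypersurfaces as local graphs\<close>

text \<open>Tangent vectors are defined by smooth curves, so smoothness must pass from a
  parametrisation to its restriction to a line. The derivative of the restriction is a scaled
  restriction of \<open>dird w f\<close>, so the induction closes.\<close>

lemma Ck_on_line:
  fixes f :: "'a::euclidean_space \<Rightarrow> 'b::euclidean_space"
  assumes T: "open T" and S: "\<And>t. t \<in> T \<Longrightarrow> x + t *\<^sub>R w \<in> S" and f: "Ck_on k f S"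
  shows "Ck_on k (\<lambda>t::real. f (x + t *\<^sub>R w)) T"
  using f
proof (induction k arbitrary: f)
  case 0
  have "continuous_on T (\<lambda>t. x + t *\<^sub>R w)" by (intro continuous_intros)
  then show ?case using 0 S by (auto intro: continuous_on_compose2)
next
  case (Suc k)
  have D: "((\<lambda>t. f (x + t *\<^sub>R w)) has_derivative (\<lambda>h. h *\<^sub>R dird w f (x + t *\<^sub>R w))) (at t)"
    if "t \<in> T" for t
  proof -
    have d: "f differentiable (at (x + t *\<^sub>R w))"
      using Suc.prems S[OF that] by (simp add: Ck_on_Suc_dird)
    have "((\<lambda>t. x + t *\<^sub>R w) has_derivative (\<lambda>h. h *\<^sub>R w)) (at t)"
      by (auto intro!: derivative_eq_intros)
    from diff_chain_at[OF this dird_has_derivative[OF d]] show ?thesis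
      by (simp add: o_def linear_cmul[OF linear_dird[OF d]])
  qed
  have "Ck_on k (\<lambda>t. h *\<^sub>R dird w f (x + t *\<^sub>R w)) T" for h
    by (rule Ck_on_linear_image[OF T])
      (use Suc in \<open>auto simp: Ck_on_Suc_dird linear_iff scaleR_add_right\<close>)
  then show ?case by (rule Ck_on_SucI[OF T D, rotated])
qed

lemma smooth_on_ident: "smooth_on (\<lambda>x. x) S"
proof -
  have "Ck_on k (\<lambda>x. x) S" for k
  proof (cases k)
    case (Suc m)
    have "dird v (\<lambda>x. x) = (\<lambda>x. v)" for v :: 'a
      by (rule ext) (rule dird_eqI[OF has_derivative_ident])
    then show ?thesis using Suc by (simp add: Ck_on_Suc_dird Ck_on_const)
  qed simp
  then show ?thesis by (simp add: smooth_on_def)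
qed

section \<open>Tangent spaces and the normal field\<close>

lemma velocity_in_tangent_space:
  fixes \<Psi> :: "'b::euclidean_space \<Rightarrow> 'a::euclidean_space"
  assumes B: "open B" "y \<in> B" and \<Psi>: "smooth_on \<Psi> B" "\<Psi> ` B \<subseteq> S"
  shows "dird v \<Psi> y \<in> tangent_space S (\<Psi> y)"
proof -
  have "open ((\<lambda>t. y + t *\<^sub>R v) -` B)"
    by (intro open_vimage B(1) continuous_intros)
  moreover have "0 \<in> (\<lambda>t. y + t *\<^sub>R v) -` B" using B(2) by simp
  ultimately obtain e where e: "e > 0" "ball (0::real) e \<subseteq> (\<lambda>t. y + t *\<^sub>R v) -` B"
    by (rule openE)
  have ball: "ball 0 e = {-e<..<e}" by (auto simp: ball_def dist_real_def)
  have mem: "y + t *\<^sub>R v \<in> B" if "t \<in> {-e<..<e}" for t using e(2) that ball by blast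
  have "smooth_on (\<lambda>t. \<Psi> (y + t *\<^sub>R v)) {-e<..<e}"
    using \<Psi>(1) mem unfolding smooth_on_def by (blast intro: Ck_on_line open_greaterThanLessThan)
  moreover have "((\<lambda>t. \<Psi> (y + t *\<^sub>R v)) has_vector_derivative dird v \<Psi> y) (at 0)"
  proof -
    have d: "\<Psi> differentiable (at (y + 0 *\<^sub>R v))"
      using smooth_on_differentiable[OF \<Psi>(1) B(2)] by simp
    have "((\<lambda>t. y + t *\<^sub>R v) has_derivative (\<lambda>h. h *\<^sub>R v)) (at 0)"
      by (auto intro!: derivative_eq_intros)
    from diff_chain_at[OF this dird_has_derivative[OF d]] show ?thesis
      by (simp add: o_def has_vector_derivative_def linear_cmul[OF linear_dird] smooth_on_differentiable[OF \<Psi>(1) B(2)])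
  qed
  ultimately show ?thesis
    unfolding tangent_space_def using e(1) \<Psi>(2) mem
    by (intro CollectI exI[of _ "\<lambda>t. \<Psi> (y + t *\<^sub>R v)"] exI[of _ e]) auto
qed

lemma hypersurface_chart:
  fixes \<Sigma> :: "('n::finite) ambient set"
  assumes "smooth_hypersurface \<Sigma>" "p \<in> \<Sigma>"
  obtains U and \<phi> :: "real^'n \<Rightarrow> 'n ambient" and x0 where "open U" "smooth_on \<phi> U" "\<phi> ` U \<subseteq> \<Sigma>" "x0 \<in> U" "\<phi> x0 = p"
    "\<And>x. x \<in> U \<Longrightarrow> inj (\<lambda>v. dird v \<phi> x)"
proof -
  obtain W :: "'n ambient set" and U and \<phi> :: "real^'n \<Rightarrow> 'n ambient" and \<psi>
    where *: "open W" "p \<in> W" "open U" "smooth_on \<phi> U"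
    "\<forall>u\<in>U. inj (frechet_derivative \<phi> (at u))" "homeomorphism U (\<Sigma> \<inter> W) \<phi> \<psi>"
    using assms(1)[unfolded smooth_hypersurface_def, rule_format, OF assms(2)] by blast
  have "\<phi> ` U = \<Sigma> \<inter> W" using *(6) by (simp add: homeomorphism_def)
  then obtain x0 where "x0 \<in> U" "\<phi> x0 = p" using assms(2) *(2) by (metis IntI imageE)
  with * \<open>\<phi> ` U = \<Sigma> \<inter> W\<close> show thesis
    by (intro that[of U \<phi> x0]) (auto simp: dird_def)
qed

lemma unit_normal_field_orthogonal:
  "unit_normal_field S \<nu> \<Longrightarrow> p \<in> S \<Longrightarrow> v \<in> tangent_space S p \<Longrightarrow> v \<bullet> \<nu> p = 0"
  unfolding unit_normal_field_def by (subst inner_commute) blast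

text \<open>A squeeze by dimension: the image of the chart derivative lies in the tangent space,
  which lies in the hyperplane, and both ends have dimension n. In particular the velocities form a
  linear subspace, which their definition by curves does not show.\<close>

lemma tangent_space_eq_orthogonal:
  fixes \<Sigma> :: "('n::finite) ambient set"
  assumes \<Sigma>: "smooth_hypersurface \<Sigma>" "unit_normal_field \<Sigma> \<nu>" "p \<in> \<Sigma>"
  shows "tangent_space \<Sigma> p = {v. v \<bullet> \<nu> p = 0}"
proof -
  obtain U and \<phi> :: "real^'n \<Rightarrow> 'n ambient" and x0 where *: "open U" "smooth_on \<phi> U" "\<phi> ` U \<subseteq> \<Sigma>" "x0 \<in> U" "\<phi> x0 = p"
    "\<And>x. x \<in> U \<Longrightarrow> inj (\<lambda>v. dird v \<phi> x)"
    using hypersurface_chart[OF \<Sigma>(1,3)] by blast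
  define L where "L v = dird v \<phi> x0" for v
  have L: "linear L" "inj L"
    unfolding L_def using *(6)[OF *(4)] linear_dird[OF smooth_on_differentiable[OF *(2,4)]] by auto
  have sub1: "range L \<subseteq> tangent_space \<Sigma> p"
    unfolding L_def using velocity_in_tangent_space[OF *(1,4,2,3)] *(5) by auto
  have sub2: "tangent_space \<Sigma> p \<subseteq> {v. v \<bullet> \<nu> p = 0}"
    using unit_normal_field_orthogonal[OF \<Sigma>(2,3)] by blast
  have nz: "\<nu> p \<noteq> 0" using \<Sigma>(2,3) unfolding unit_normal_field_def by force
  have "dim (range L) = CARD('n)"
    using dim_image_eq[OF L(1), of UNIV] L(2) by (simp add: inj_on_subset)
  moreover have "dim {v. v \<bullet> \<nu> p = 0} = CARD('n)"
    using dim_hyperplane[OF nz] by (simp add: inner_commute)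
  moreover have "subspace (range L)" using L(1) by (simp add: linear_subspace_image)
  moreover have "subspace {v. v \<bullet> \<nu> p = 0}" using subspace_hyperplane[of "\<nu> p"] by (simp add: inner_commute)
  ultimately have "range L = {v. v \<bullet> \<nu> p = 0}"
    using sub1 sub2 by (intro subspace_dim_equal) auto
  then show ?thesis using sub1 sub2 by blast
qed

text \<open>Trades the derivative within \<open>\<Sigma>\<close> for the ordinary derivative of a
  smooth function on an open set, where the chain rule and continuity are available.\<close>

lemma unit_normal_field_extension:
  fixes \<Sigma> :: "'a::euclidean_space set"
  assumes "unit_normal_field \<Sigma> \<nu>" "p \<in> \<Sigma>"
  obtains W F where "open W" "p \<in> W" "smooth_on F W" "\<And>x. x \<in> \<Sigma> \<inter> W \<Longrightarrow> F x = \<nu> x"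
    "\<And>q X. q \<in> \<Sigma> \<inter> W \<Longrightarrow> X \<in> tangent_space \<Sigma> q \<Longrightarrow> tangential_derivative \<Sigma> \<nu> q X = dird X F q"
proof -
  obtain W F where *: "open W" "p \<in> W" "smooth_on F W" "\<And>x. x \<in> \<Sigma> \<inter> W \<Longrightarrow> F x = \<nu> x"
    using assms unfolding unit_normal_field_def smooth_along_def by meson
  have "tangential_derivative \<Sigma> \<nu> q X = dird X F q"
    if q: "q \<in> \<Sigma> \<inter> W" and X: "X \<in> tangent_space \<Sigma> q" for q X
  proof -
    have D: "(F has_derivative (\<lambda>v. dird v F q)) (at q within \<Sigma>)"
      using dird_has_derivative[OF smooth_on_differentiable[OF *(3), of q]] q
      by (auto intro: has_derivative_at_withinI)
    obtain d where d: "d > 0" "ball q d \<subseteq> W" using *(1) q openE by blast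
    have "(\<nu> has_derivative (\<lambda>v. dird v F q)) (at q within \<Sigma>)"
      by (rule has_derivative_transform_within[OF D d(1)])
        (use q *(4) d(2) in \<open>auto simp: subset_iff dist_commute\<close>)
    from tangential_derivative_eq[OF this X] show ?thesis .
  qed
  with * show thesis by (rule that)
qed

lemma unit_normal_field_continuous:
  fixes \<Sigma> :: "'a::euclidean_space set"
  assumes "unit_normal_field \<Sigma> \<nu>"
  shows "continuous_on \<Sigma> \<nu>"
proof (clarsimp simp: continuous_on_eq_continuous_within)
  fix p assume p: "p \<in> \<Sigma>"
  obtain W F where *: "open W" "p \<in> W" "smooth_on F W" "\<And>x. x \<in> \<Sigma> \<inter> W \<Longrightarrow> F x = \<nu> x"
    using unit_normal_field_extension[OF assms p] by metis
  have c: "continuous (at p within \<Sigma>) F"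
    using smooth_on_differentiable[OF *(3,2)] differentiable_imp_continuous_within
      continuous_at_imp_continuous_at_within by blast
  obtain d where d: "d > 0" "ball p d \<subseteq> W" using *(1,2) openE by blast
  show "continuous (at p within \<Sigma>) \<nu>"
    by (rule continuous_transform_within[OF c d(1) p])
      (use p *(4) d(2) in \<open>auto simp: subset_iff dist_commute\<close>)
qed

section \<open>Frames of a tangent hyperplane and graphs over it\<close>

locale adapted_frame =
  fixes \<tau> :: "real^'n \<Rightarrow> ('n::finite) ambient" and N0 :: "'n ambient"
  assumes linear_frame: "linear \<tau>" and norm_frame: "norm (\<tau> x) = norm x"
    and norm_normal: "norm N0 = 1" and range_frame: "range \<tau> = {v. v \<bullet> N0 = 0}"
begin

text \<open>Orthogonal projection along \<open>N0\<close> followed by the inverse of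
  \<open>\<tau>\<close>. It is defined on all ambient vectors, so that it also applies to normals
  and to vectors tangent at other points.\<close>

definition coords :: "'n ambient \<Rightarrow> real^'n" where
  "coords X = (\<chi> i. X \<bullet> \<tau> (axis i 1))"

lemma inner_frame: "\<tau> x \<bullet> \<tau> y = x \<bullet> y"
  by (simp add: dot_norm linear_add[OF linear_frame, symmetric] norm_frame)

lemma frame_normal [simp]: "\<tau> x \<bullet> N0 = 0" "N0 \<bullet> \<tau> x = 0"
  using range_frame by (auto simp: inner_commute)

lemma normal_normal [simp]: "N0 \<bullet> N0 = 1"
  using norm_normal by (simp add: norm_eq_1)

lemma coords_frame [simp]: "coords (\<tau> x) = x"
  by (simp add: coords_def inner_frame inner_axis vec_eq_iff)

lemma linear_coords: "linear coords"
  by (auto simp: linear_iff coords_def vec_eq_iff inner_add_left)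

lemma frame_decomposition: "X = \<tau> (coords X) + (X \<bullet> N0) *\<^sub>R N0"
proof -
  have "X - (X \<bullet> N0) *\<^sub>R N0 \<in> range \<tau>"
    unfolding range_frame by (simp add: inner_diff_left)
  then obtain x where x: "X = \<tau> x + (X \<bullet> N0) *\<^sub>R N0"
    by (metis diff_add_cancel imageE)
  have "coords X = coords (\<tau> x + (X \<bullet> N0) *\<^sub>R N0)" using x by simp
  also have "\<dots> = x"
    using linear_add[OF linear_coords] linear_cmul[OF linear_coords] by (simp add: coords_def[of N0] vec_eq_iff)
  finally show ?thesis using x by simp
qed

lemma inner_decomposition: "X \<bullet> Y = coords X \<bullet> coords Y + (X \<bullet> N0) * (Y \<bullet> N0)"
proof -
  have "X \<bullet> Y = (\<tau> (coords X) + (X \<bullet> N0) *\<^sub>R N0) \<bullet> (\<tau> (coords Y) + (Y \<bullet> N0) *\<^sub>R N0)"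
    using frame_decomposition by metis
  then show ?thesis by (simp add: inner_add_left inner_add_right inner_frame)
qed

definition graph_map :: "'n ambient \<Rightarrow> (real^'n \<Rightarrow> real) \<Rightarrow> real^'n \<Rightarrow> 'n ambient" where
  "graph_map p u y = p + \<tau> y + u y *\<^sub>R N0"

lemma smooth_on_graph_map:
  assumes "open B" "smooth_on u B"
  shows "smooth_on (graph_map p u) B"
proof -
  have "smooth_on (\<lambda>y. p + \<tau> y + u y *\<^sub>R N0) B"
    by (intro smooth_on_add smooth_on_const smooth_on_linear_image[OF assms(1) linear_frame]
        smooth_on_ident smooth_on_linear_image[OF assms(1) _ assms(2), of "\<lambda>r. r *\<^sub>R N0"] assms(1))
      (simp add: linear_iff scaleR_add_left)
  then show ?thesis by (simp add: graph_map_def[abs_def])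
qed

lemma dird_graph_map:
  assumes "u differentiable (at y)"
  shows "dird v (graph_map p u) y = \<tau> v + dird v u y *\<^sub>R N0"
proof -
  have "bounded_linear \<tau>" using linear_frame by (simp add: linear_conv_bounded_linear)
  then have "(graph_map p u has_derivative (\<lambda>v. 0 + \<tau> v + dird v u y *\<^sub>R N0)) (at y)"
    unfolding graph_map_def[abs_def]
    by (intro has_derivative_add has_derivative_const has_derivative_scaleR_left
        dird_has_derivative assms) (rule bounded_linear_imp_has_derivative)
  from dird_eqI[OF this] show ?thesis by simp
qed

text \<open>The inverse function theorem is applied to the tangential part \<open>T\<close> of a
  chart, and \<open>u\<close> is the height \<open>h\<close> composed with the local inverse. The
  gradient of \<open>u\<close> vanishes at 0 because velocities of the graph at \<open>p\<close> are
  tangent, hence orthogonal to \<open>N0\<close>.\<close>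

lemma local_graph:
  assumes \<Sigma>: "smooth_hypersurface \<Sigma>" "unit_normal_field \<Sigma> \<nu>" "p \<in> \<Sigma>" and N0: "N0 = \<nu> p"
  obtains B u where "open B" "0 \<in> B" "smooth_on u B" "u 0 = 0" "\<And>v. dird v u 0 = 0"
    "\<And>y. y \<in> B \<Longrightarrow> graph_map p u y \<in> \<Sigma>"
proof -
  obtain U and \<phi> :: "real^'n \<Rightarrow> 'n ambient" and x0 where *: "open U" "smooth_on \<phi> U" "\<phi> ` U \<subseteq> \<Sigma>" "x0 \<in> U" "\<phi> x0 = p"
    "\<And>x. x \<in> U \<Longrightarrow> inj (\<lambda>v. dird v \<phi> x)"
    using hypersurface_chart[OF \<Sigma>(1,3)] by blast
  have \<phi>d: "\<phi> differentiable (at x)" if "x \<in> U" for x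
    using smooth_on_differentiable[OF *(2) that] .
  define T where "T x = coords (\<phi> x - p)" for x
  define h where "h x = (\<phi> x - p) \<bullet> N0" for x
  have \<phi>p: "smooth_on (\<lambda>x. \<phi> x - p) U"
    using smooth_on_add[OF *(1,2) smooth_on_const[of "- p"]] by simp
  have T: "smooth_on T U"
    unfolding T_def by (rule smooth_on_linear_image[OF *(1) linear_coords \<phi>p])
  have h: "smooth_on h U"
    unfolding h_def by (rule smooth_on_linear_image[OF *(1) _ \<phi>p]) (simp add: linear_iff inner_add_left)
  have dT: "dird v T x = coords (dird v \<phi> x)" if "x \<in> U" for v x
  proof -
    have "((\<lambda>x. \<phi> x - p) has_derivative (\<lambda>v. dird v \<phi> x)) (at x)"
      using has_derivative_diff[OF dird_has_derivative[OF \<phi>d[OF that]] has_derivative_const[of p]] by simp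
    then have "(T has_derivative (\<lambda>v. coords (dird v \<phi> x))) (at x)"
      unfolding T_def using linear_coords[unfolded linear_conv_bounded_linear]
      by (rule bounded_linear.has_derivative[rotated])
    then show ?thesis by (rule dird_eqI)
  qed
  have linT: "linear (\<lambda>v. dird v T x)" if "x \<in> U" for x
    using linear_dird[OF smooth_on_differentiable[OF T that]] .
  \<comment> \<open>A vector in the kernel has a chart derivative that is parallel to
    \<open>N0\<close> and, being tangent, orthogonal to it, hence zero.\<close>
  have injT: "inj (\<lambda>v. dird v T x0)"
    unfolding linear_injective_0[OF linT[OF *(4)]]
  proof (intro allI impI)
    fix v assume v: "dird v T x0 = 0"
    have "dird v \<phi> x0 \<in> tangent_space \<Sigma> p"
      using velocity_in_tangent_space[OF *(1,4,2,3)] *(5) by simp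
    then have "dird v \<phi> x0 \<bullet> N0 = 0"
      unfolding N0 by (rule unit_normal_field_orthogonal[OF \<Sigma>(2,3)])
    then have "dird v \<phi> x0 = 0"
      using frame_decomposition[of "dird v \<phi> x0"] v dT[OF *(4)] linear_0[OF linear_frame] by simp
    then show "v = 0"
      using *(6)[OF *(4)] linear_injective_0[OF linear_dird[OF \<phi>d[OF *(4)]]] by blast
  qed
  \<comment> \<open>The inverse function theorem takes the derivative as a continuous map into
    bounded linear operators; continuity is checked on basis vectors.\<close>
  define T' where "T' x = Blinfun (\<lambda>v. dird v T x)" for x
  have T': "blinfun_apply (T' x) = (\<lambda>v. dird v T x)" if "x \<in> U" for x
    unfolding T'_def using linT[OF that] by (simp add: bounded_linear_Blinfun_apply linear_conv_bounded_linear)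
  obtain l where l: "linear l" "l \<circ> (\<lambda>v. dird v T x0) = id"
    using linear_injective_left_inverse[OF linT[OF *(4)] injT] by blast
  have der: "(T has_derivative blinfun_apply (T' x)) (at x)" if "x \<in> U" for x
    using dird_has_derivative[OF smooth_on_differentiable[OF T that]] T'[OF that] by simp
  have cont: "continuous_on U T'"
  proof (rule continuous_on_blinfun_componentwise)
    fix i :: "real^'n" assume "i \<in> Basis"
    have "continuous_on U (dird i T)" by (rule smooth_on_continuous[OF smooth_on_dird[OF T]])
    then show "continuous_on U (\<lambda>x. blinfun_apply (T' x) i)"
      by (rule continuous_on_eq) (simp add: T')
  qed
  have inv: "Blinfun l o\<^sub>L T' x0 = id_blinfun"
    using l T'[OF *(4)]
    by (intro blinfun_eqI) (simp add: bounded_linear_Blinfun_apply linear_conv_bounded_linear fun_eq_iff)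
  obtain U' B g g' where I: "open U'" "U' \<subseteq> U" "x0 \<in> U'" "open B" "T x0 \<in> B" "homeomorphism U' B T g"
    "\<And>y. y \<in> B \<Longrightarrow> (g has_derivative (g' y)) (at y)"
    "\<And>y. y \<in> B \<Longrightarrow> g' y = inv (blinfun_apply (T' (g y)))"
    "\<And>y. y \<in> B \<Longrightarrow> bij (blinfun_apply (T' (g y)))"
    using inverse_function_theorem[OF *(1) der cont *(4) inv] by metis
  have gB: "g ` B = U'" and Tg: "\<And>y. y \<in> B \<Longrightarrow> T (g y) = y" and gT: "\<And>x. x \<in> U' \<Longrightarrow> g (T x) = x"
    using I(6) by (auto simp: homeomorphism_def)
  have Tx0: "T x0 = 0" using *(5) linear_0[OF linear_coords] by (simp add: T_def)
  define u where "u y = h (g y)" for y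
  have u: "smooth_on u B" unfolding u_def
  proof (rule smooth_on_compose_local_inverse[OF I(1,4)])
    show "smooth_on T U'" "smooth_on h U'" using T h I(2) smooth_on_subset by blast+
    show "g ` B \<subseteq> U'" using gB by simp
    show "bij (\<lambda>v. dird v T x)" if "x \<in> U'" for x
      using I(9) T' that gB I(2) by (metis imageE subsetD)
    show "(g has_derivative inv (\<lambda>v. dird v T (g y))) (at y)" if "y \<in> B" for y
      using I(7,8)[OF that] T'[of "g y"] that gB I(2) by (metis imageI subsetD)
  qed
  have graph: "graph_map p u y = \<phi> (g y)" if "y \<in> B" for y
    using frame_decomposition[of "\<phi> (g y) - p"] Tg[OF that]
    by (simp add: graph_map_def u_def h_def T_def algebra_simps)
  have in\<Sigma>: "graph_map p u y \<in> \<Sigma>" if "y \<in> B" for y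
    unfolding graph[OF that] using that gB I(2) *(3) by blast
  show thesis
  proof (rule that[OF I(4) _ u _ _ in\<Sigma>])
    show 0: "0 \<in> B" using I(5) Tx0 by simp
    show "u 0 = 0"
      using gT[OF I(3)] Tx0 *(5) by (simp add: u_def h_def)
    show "dird v u 0 = 0" for v
    proof -
      have "graph_map p u 0 = p"
        using graph[OF 0] gT[OF I(3)] Tx0 *(5) by simp
      then have "dird v (graph_map p u) 0 \<in> tangent_space \<Sigma> p"
        using velocity_in_tangent_space[OF I(4) 0 smooth_on_graph_map[OF I(4) u, of p], where S = \<Sigma> and v = v] in\<Sigma>
        by auto
      then have "dird v (graph_map p u) 0 \<bullet> N0 = 0"
        unfolding N0 by (rule unit_normal_field_orthogonal[OF \<Sigma>(2,3)])
      then show ?thesis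
        by (simp add: dird_graph_map[OF smooth_on_differentiable[OF u 0]] inner_add_left)
    qed
  qed
qed

text \<open>Orthogonality to the lifted vectors makes the normal proportional to (-Du, 1); unit
  length and the sign in \<open>pos\<close> fix the factor. Differentiating the same orthogonality
  relation along the graph gives the second fundamental form, since the derivative of a lifted
  constant vector has only a component along \<open>N0\<close>.\<close>

lemma graph_geometry:
  assumes \<Sigma>: "smooth_hypersurface \<Sigma>" "unit_normal_field \<Sigma> \<nu>"
    and B: "open B" and u: "smooth_on u B"
    and graph: "\<And>y. y \<in> B \<Longrightarrow> graph_map p u y \<in> \<Sigma>"
    and pos: "\<And>y. y \<in> B \<Longrightarrow> 0 < \<nu> (graph_map p u y) \<bullet> N0"
    and y: "y \<in> B"
  defines "N \<equiv> \<nu> (graph_map p u y)"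
    and "s \<equiv> \<Sum>i\<in>UNIV. dird (axis i 1) u y * dird (axis i 1) u y"
  shows graph_normal: "N \<bullet> \<tau> v = - dird v u y * (N \<bullet> N0)"
    and graph_normal_height: "N \<bullet> N0 = 1 / sqrt (1 + s)"
    and graph_tangent: "tangent_space \<Sigma> (graph_map p u y) = range (\<lambda>v. \<tau> v + dird v u y *\<^sub>R N0)"
    and graph_second_fundamental_form:
      "X \<in> tangent_space \<Sigma> (graph_map p u y) \<Longrightarrow> Y \<in> tangent_space \<Sigma> (graph_map p u y) \<Longrightarrow>
        second_fundamental_form \<Sigma> \<nu> (graph_map p u y) X Y
          = - dird (coords X) (dird (coords Y) u) y * (N \<bullet> N0)"
proof -
  have ud: "u differentiable (at z)" if "z \<in> B" for z
    using smooth_on_differentiable[OF u that] .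
  have tang: "\<tau> v + dird v u z *\<^sub>R N0 \<in> tangent_space \<Sigma> (graph_map p u z)" if "z \<in> B" for v z
  proof -
    have "graph_map p u ` B \<subseteq> \<Sigma>" using graph by blast
    from velocity_in_tangent_space[OF B that smooth_on_graph_map[OF B u] this, of v] show ?thesis
      unfolding dird_graph_map[OF ud[OF that]] .
  qed
  have orth: "\<nu> (graph_map p u z) \<bullet> (\<tau> v + dird v u z *\<^sub>R N0) = 0" if "z \<in> B" for v z
    using unit_normal_field_orthogonal[OF \<Sigma>(2) graph[OF that] tang[OF that]] by (simp add: inner_commute)
  show nt: "N \<bullet> \<tau> v = - dird v u y * (N \<bullet> N0)" for v
    using orth[OF y, of v] by (simp add: N_def inner_add_right)
  have "N \<bullet> N = 1"
    using \<Sigma>(2) graph[OF y] unfolding unit_normal_field_def N_def by (simp add: norm_eq_1)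
  moreover have "coords N \<bullet> coords N = s * (N \<bullet> N0)\<^sup>2"
    unfolding s_def sum_distrib_right inner_vec_def
    by (intro sum.cong refl) (simp add: coords_def nt power2_eq_square)
  ultimately have eq: "(1 + s) * (N \<bullet> N0)\<^sup>2 = 1"
    using inner_decomposition[of N N] by (simp add: power2_eq_square algebra_simps)
  have s0: "0 \<le> s" unfolding s_def by (intro sum_nonneg) simp
  have "(sqrt (1 + s) * (N \<bullet> N0))\<^sup>2 = 1\<^sup>2" using eq s0 by (simp add: power_mult_distrib)
  then have "sqrt (1 + s) * (N \<bullet> N0) = 1"
    using pos[OF y] s0 by (subst (asm) power2_eq_iff_nonneg) (auto simp: N_def)
  then show height: "N \<bullet> N0 = 1 / sqrt (1 + s)"
    using s0 by (simp add: field_simps)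
  have T: "tangent_space \<Sigma> (graph_map p u y) = {X. X \<bullet> N = 0}"
    unfolding N_def by (rule tangent_space_eq_orthogonal[OF \<Sigma> graph[OF y]])
  have tangent_eq: "X = \<tau> (coords X) + dird (coords X) u y *\<^sub>R N0" if "X \<bullet> N = 0" for X
  proof -
    have "X \<bullet> N = \<tau> (coords X) \<bullet> N + (X \<bullet> N0) * (N0 \<bullet> N)"
      by (subst frame_decomposition[of X]) (simp add: inner_add_left)
    also have "\<dots> = (X \<bullet> N0 - dird (coords X) u y) * (N \<bullet> N0)"
      using nt[of "coords X"] by (simp add: inner_commute algebra_simps)
    finally have "X \<bullet> N0 = dird (coords X) u y"
      using that pos[OF y] by (simp add: N_def)
    then show ?thesis using frame_decomposition[of X] by simp
  qed
  show "tangent_space \<Sigma> (graph_map p u y) = range (\<lambda>v. \<tau> v + dird v u y *\<^sub>R N0)"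
    using tangent_eq tang[OF y] T by blast
  show "second_fundamental_form \<Sigma> \<nu> (graph_map p u y) X Y
          = - dird (coords X) (dird (coords Y) u) y * (N \<bullet> N0)"
    if X: "X \<in> tangent_space \<Sigma> (graph_map p u y)" and Y: "Y \<in> tangent_space \<Sigma> (graph_map p u y)"
  proof -
    define v w where "v = coords X" and "w = coords Y"
    have Xv: "X = \<tau> v + dird v u y *\<^sub>R N0" and Yw: "Y = \<tau> w + dird w u y *\<^sub>R N0"
      using tangent_eq X Y T by (auto simp: v_def w_def)
    obtain W F where W: "open W" "graph_map p u y \<in> W" "smooth_on F W" "\<And>x. x \<in> \<Sigma> \<inter> W \<Longrightarrow> F x = \<nu> x"
      "\<And>q X. q \<in> \<Sigma> \<inter> W \<Longrightarrow> X \<in> tangent_space \<Sigma> q \<Longrightarrow> tangential_derivative \<Sigma> \<nu> q X = dird X F q"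
      using unit_normal_field_extension[OF \<Sigma>(2) graph[OF y]] by blast
    \<comment> \<open>It vanishes on the open set \<open>B'\<close>, so its derivative is 0 at
      \<open>y\<close>; the product rule then exchanges a derivative of the normal for a second
      derivative of \<open>u\<close>.\<close>
    define Q where "Q z = F (graph_map p u z) \<bullet> (\<tau> w + dird w u z *\<^sub>R N0)" for z
    define B' where "B' = B \<inter> graph_map p u -` W"
    have gc: "continuous_on B (graph_map p u)"
      by (rule smooth_on_continuous[OF smooth_on_graph_map[OF B u]])
    have B': "open B'" "y \<in> B'"
      using continuous_open_preimage[OF gc B W(1)] y W(2) by (auto simp: B'_def)
    have Q0: "Q z = 0" if "z \<in> B'" for z
      using that orth[of z w] graph[of z] W(4)[of "graph_map p u z"] by (simp add: Q_def B'_def)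
    have DF: "(F has_derivative (\<lambda>X. dird X F (graph_map p u y))) (at (graph_map p u y))"
      by (rule dird_has_derivative[OF smooth_on_differentiable[OF W(3,2)]])
    have Dg: "(graph_map p u has_derivative (\<lambda>v. \<tau> v + dird v u y *\<^sub>R N0)) (at y)"
      using dird_has_derivative[OF smooth_on_differentiable[OF smooth_on_graph_map[OF B u] y]]
        dird_graph_map[OF ud[OF y]] by simp
    have D1: "((\<lambda>z. F (graph_map p u z)) has_derivative
        (\<lambda>v. dird (\<tau> v + dird v u y *\<^sub>R N0) F (graph_map p u y))) (at y)"
      using diff_chain_at[OF Dg DF] by (simp add: o_def)
    have D2: "((\<lambda>z. \<tau> w + dird w u z *\<^sub>R N0) has_derivative (\<lambda>v. 0 + dird v (dird w u) y *\<^sub>R N0)) (at y)"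
      by (intro has_derivative_add has_derivative_const has_derivative_scaleR_left dird_has_derivative
          smooth_on_differentiable[OF smooth_on_dird[OF u] y])
    have "(Q has_derivative (\<lambda>v. F (graph_map p u y) \<bullet> (0 + dird v (dird w u) y *\<^sub>R N0)
        + dird (\<tau> v + dird v u y *\<^sub>R N0) F (graph_map p u y) \<bullet> (\<tau> w + dird w u y *\<^sub>R N0))) (at y)"
      unfolding Q_def[abs_def] by (rule has_derivative_inner[OF D1 D2])
    from dird_eqI[OF this, of v]
    have "dird v Q y = N \<bullet> (dird v (dird w u) y *\<^sub>R N0) + dird X F (graph_map p u y) \<bullet> Y"
      using W(4)[of "graph_map p u y"] W(2) graph[OF y] by (simp add: Xv[symmetric] Yw[symmetric] N_def)
    moreover have "dird v Q y = dird v (\<lambda>_. 0) y"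
      using B' Q0 by (rule dird_cong)
    moreover have "dird v (\<lambda>_. 0::real) y = 0"
      using dird_eqI[OF has_derivative_const] .
    moreover have "tangential_derivative \<Sigma> \<nu> (graph_map p u y) X = dird X F (graph_map p u y)"
      using W(5) W(2) graph[OF y] X by blast
    ultimately show ?thesis
      unfolding second_fundamental_form_def v_def w_def by simp
  qed
qed

end

section \<open>Traces over tangent bases and the translator equation of a graph\<close>

lemma orthonormal_basis_of_tangent_basis:
  fixes \<Sigma> :: "('n::finite) ambient set"
  assumes "smooth_hypersurface \<Sigma>" "unit_normal_field \<Sigma> \<nu>" "p \<in> \<Sigma>"
  shows "orthonormal_basis_of (tangent_space \<Sigma> p) (tangent_basis \<Sigma> p)"
    and "finite (tangent_basis \<Sigma> p)" and "card (tangent_basis \<Sigma> p) = CARD('n)"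
proof -
  have T: "tangent_space \<Sigma> p = {v. v \<bullet> \<nu> p = 0}"
    by (rule tangent_space_eq_orthogonal[OF assms])
  have nz: "\<nu> p \<noteq> 0" using assms(2,3) unfolding unit_normal_field_def by force
  have sub: "subspace (tangent_space \<Sigma> p)"
    unfolding T using subspace_hyperplane[of "\<nu> p"] by (simp add: inner_commute)
  have dim: "dim (tangent_space \<Sigma> p) = CARD('n)"
    unfolding T using dim_hyperplane[OF nz] by (simp add: inner_commute)
  obtain C where "C \<subseteq> tangent_space \<Sigma> p" "pairwise orthogonal C" "\<And>x. x \<in> C \<Longrightarrow> norm x = 1"
      "span C = tangent_space \<Sigma> p"
    using orthonormal_basis_subspace[OF sub] by metis
  then have "orthonormal_basis_of (tangent_space \<Sigma> p) C"
    unfolding orthonormal_basis_of_def by blast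
  then show *: "orthonormal_basis_of (tangent_space \<Sigma> p) (tangent_basis \<Sigma> p)"
    unfolding tangent_basis_def by (rule someI)
  then have ob: "pairwise orthogonal (tangent_basis \<Sigma> p)" "\<And>b. b \<in> tangent_basis \<Sigma> p \<Longrightarrow> norm b = 1"
    "span (tangent_basis \<Sigma> p) = tangent_space \<Sigma> p"
    unfolding orthonormal_basis_of_def by auto
  have "0 \<notin> tangent_basis \<Sigma> p"
    using ob(2)[of 0] by (metis norm_zero zero_neq_one)
  with ob(1) have "independent (tangent_basis \<Sigma> p)"
    by (rule pairwise_orthogonal_independent)
  then show "finite (tangent_basis \<Sigma> p)" "card (tangent_basis \<Sigma> p) = CARD('n)"
    using dim ob(3) by (auto intro: independent_imp_finite dest: dim_span_eq_card_independent)
qed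

context adapted_frame
begin

text \<open>A tangent basis together with the normal is an orthonormal basis of the ambient space, over
  which the trace of the bilinear form is the one in the coordinates of the frame.\<close>

lemma graph_translator_equation:
  assumes \<Sigma>: "translator \<Sigma> \<nu>"
    and B: "open B" and u: "smooth_on u B"
    and graph: "\<And>y. y \<in> B \<Longrightarrow> graph_map p u y \<in> \<Sigma>"
    and pos: "\<And>y. y \<in> B \<Longrightarrow> 0 < \<nu> (graph_map p u y) \<bullet> N0"
    and y: "y \<in> B"
  defines "D i \<equiv> dird (axis i 1)"
  defines "s \<equiv> \<Sum>i\<in>UNIV. D i u y * D i u y"
  shows "(\<Sum>i\<in>UNIV. D i (D i u) y) * (1 + s)
        - (\<Sum>i\<in>UNIV. \<Sum>j\<in>UNIV. D i u y * D j u y * D i (D j u) y)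
        = ((0, 1) \<bullet> N0 - (\<Sum>i\<in>UNIV. coords (0, 1) $ i * D i u y)) * (1 + s)"
proof -
  have tr: "smooth_hypersurface \<Sigma>" "unit_normal_field \<Sigma> \<nu>"
    "\<And>q. q \<in> \<Sigma> \<Longrightarrow> mean_curvature \<Sigma> \<nu> q = - ((0, 1) \<bullet> \<nu> q)"
    using \<Sigma> unfolding translator_def by auto
  note G = graph_geometry[OF tr(1,2) B u graph pos y]
  define q where "q = graph_map p u y"
  define N where "N = \<nu> q"
  define T where "T = tangent_basis \<Sigma> q"
  define A where "A i j = D i (D j u) y" for i j
  define \<beta> where "\<beta> X Y = (\<Sum>i\<in>UNIV. \<Sum>j\<in>UNIV. coords X $ i * coords Y $ j * A i j)" for X Y
  have q: "q \<in> \<Sigma>" using graph[OF y] by (simp add: q_def)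
  have ob: "pairwise orthogonal T" "\<And>b. b \<in> T \<Longrightarrow> norm b = 1" "span T = tangent_space \<Sigma> q" "finite T"
    "T \<subseteq> tangent_space \<Sigma> q"
    using orthonormal_basis_of_tangent_basis[OF tr(1,2) q] unfolding orthonormal_basis_of_def T_def by auto
  have Tq: "tangent_space \<Sigma> q = {X. X \<bullet> N = 0}"
    unfolding N_def by (rule tangent_space_eq_orthogonal[OF tr(1,2) q])
  have N1: "norm N = 1" using tr(2) q unfolding unit_normal_field_def N_def by blast
  have \<beta>: "dird (coords X) (dird (coords Y) u) y = \<beta> X Y" for X Y
  proof -
    have 1: "dird (coords Y) u z = (\<Sum>j\<in>UNIV. coords Y $ j * D j u z)" if "z \<in> B" for z
      unfolding D_def by (rule dird_axis_expansion[OF smooth_on_differentiable[OF u that]])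
    have "dird (coords X) (dird (coords Y) u) y = dird (coords X) (\<lambda>z. \<Sum>j\<in>UNIV. coords Y $ j * D j u z) y"
      by (rule dird_cong[OF B y 1])
    also have "((\<lambda>z. \<Sum>j\<in>UNIV. coords Y $ j * D j u z) has_derivative
        (\<lambda>v. \<Sum>j\<in>UNIV. coords Y $ j * dird v (D j u) y)) (at y)"
      unfolding D_def
      by (intro has_derivative_sum has_derivative_mult_right dird_has_derivative
          smooth_on_differentiable[OF smooth_on_dird[OF u] y])
    then have "dird (coords X) (\<lambda>z. \<Sum>j\<in>UNIV. coords Y $ j * D j u z) y
        = (\<Sum>j\<in>UNIV. coords Y $ j * dird (coords X) (D j u) y)"
      by (rule dird_eqI)
    also have "\<dots> = (\<Sum>j\<in>UNIV. coords Y $ j * (\<Sum>i\<in>UNIV. coords X $ i * D i (D j u) y))"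
      unfolding D_def
      by (subst dird_axis_expansion[OF smooth_on_differentiable[OF smooth_on_dird[OF u] y]]) simp
    also have "\<dots> = \<beta> X Y"
      unfolding \<beta>_def A_def sum_distrib_left by (subst sum.swap) (simp add: algebra_simps)
    finally show ?thesis .
  qed
  have NT: "N \<notin> T" using ob(5) Tq N1 by (auto simp: norm_eq_1)
  define C where "C = insert N T"
  have C: "pairwise orthogonal C" "\<And>c. c \<in> C \<Longrightarrow> norm c = 1" "finite C"
    using ob Tq N1 unfolding C_def
    by (auto simp: pairwise_insert orthogonal_def inner_commute)
  have spanC: "x \<in> span C" for x
  proof -
    have "x - (x \<bullet> N) *\<^sub>R N \<in> span T"
      unfolding ob(3) Tq using N1 by (simp add: inner_diff_left norm_eq_1)
    then show ?thesis unfolding C_def span_insert by blast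
  qed
  have parseval: "(\<Sum>c\<in>C. (c \<bullet> x) * (c \<bullet> z)) = x \<bullet> z" for x z
  proof -
    have "(\<Sum>c\<in>C. (x \<bullet> c) *\<^sub>R c) \<bullet> z = x \<bullet> z"
      using orthonormal_basis_expand[OF C(1,2) spanC C(3)] by simp
    moreover have "(\<Sum>c\<in>C. (x \<bullet> c) *\<^sub>R c) \<bullet> z = (\<Sum>c\<in>C. (c \<bullet> x) * (c \<bullet> z))"
      unfolding inner_sum_left by (intro sum.cong refl) (simp add: inner_commute[of x])
    ultimately show ?thesis by simp
  qed
  have "(\<Sum>c\<in>C. \<beta> c c) = (\<Sum>i\<in>UNIV. A i i)"
  proof -
    have "(\<Sum>c\<in>C. \<beta> c c) = (\<Sum>i\<in>UNIV. \<Sum>j\<in>UNIV. (\<Sum>c\<in>C. (c \<bullet> \<tau> (axis i 1)) * (c \<bullet> \<tau> (axis j 1))) * A i j)"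
      unfolding \<beta>_def coords_def sum_distrib_right
      by (subst sum.swap, rule sum.cong[OF refl], subst sum.swap) simp
    also have "\<dots> = (\<Sum>i\<in>UNIV. \<Sum>j\<in>UNIV. if j = i then A i j else 0)"
      unfolding parseval by (intro sum.cong refl) (simp add: inner_frame inner_axis_axis)
    finally show ?thesis by simp
  qed
  \<comment> \<open>The surplus \<open>\<beta> N N\<close> is quadratic in the gradient, because
    \<open>coords N\<close> is a multiple of Du; multiplied by 1 + s it becomes the double sum in
    the equation.\<close>
  then have trace: "(\<Sum>b\<in>T. \<beta> b b) = (\<Sum>i\<in>UNIV. A i i) - \<beta> N N"
    using NT ob(4) by (simp add: C_def)
  have coordsN: "coords N $ i = - D i u y * (N \<bullet> N0)" for i
    using G(1)[of "axis i 1"] by (simp add: coords_def D_def N_def q_def)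
  have s0: "0 \<le> s" unfolding s_def by (intro sum_nonneg) simp
  have height: "N \<bullet> N0 = 1 / sqrt (1 + s)"
    using G(2) by (simp add: N_def q_def s_def D_def)
  then have height2: "(N \<bullet> N0) * (N \<bullet> N0) * (1 + s) = 1" and hpos: "N \<bullet> N0 > 0"
    using s0 by (auto simp: real_sqrt_mult_self add_nonneg_pos)
  have \<beta>N: "\<beta> N N = (N \<bullet> N0) * (N \<bullet> N0) * (\<Sum>i\<in>UNIV. \<Sum>j\<in>UNIV. D i u y * D j u y * A i j)"
    unfolding \<beta>_def coordsN sum_distrib_left by (simp add: algebra_simps)
  have "mean_curvature \<Sigma> \<nu> q = (\<Sum>b\<in>T. second_fundamental_form \<Sigma> \<nu> q b b)"
    by (simp add: mean_curvature_def tangential_divergence_def second_fundamental_form_def T_def)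
  also have "\<dots> = (\<Sum>b\<in>T. - \<beta> b b * (N \<bullet> N0))"
    using G(4) ob(5) by (intro sum.cong refl) (auto simp: q_def N_def \<beta>)
  also have "\<dots> = - ((\<Sum>i\<in>UNIV. A i i) - \<beta> N N) * (N \<bullet> N0)"
    unfolding trace[symmetric] by (simp add: sum_negf sum_distrib_right)
  finally have "((\<Sum>i\<in>UNIV. A i i) - \<beta> N N) * (N \<bullet> N0) = (0, 1) \<bullet> N"
    using tr(3)[OF q] unfolding N_def[symmetric] mult_minus_left by linarith
  also have "\<dots> = ((0, 1) \<bullet> N0 - (\<Sum>i\<in>UNIV. coords (0, 1) $ i * D i u y)) * (N \<bullet> N0)"
    using inner_decomposition[of "(0, 1)" N]
    by (simp add: inner_vec_def coordsN right_diff_distrib sum_distrib_left sum_negf mult_ac)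
  finally have "(\<Sum>i\<in>UNIV. A i i) - \<beta> N N = (0, 1) \<bullet> N0 - (\<Sum>i\<in>UNIV. coords (0, 1) $ i * D i u y)"
    using hpos by simp
  from arg_cong[OF this, of "\<lambda>r. r * (1 + s)"]
  have "(\<Sum>i\<in>UNIV. A i i) * (1 + s) - \<beta> N N * (1 + s)
      = ((0, 1) \<bullet> N0 - (\<Sum>i\<in>UNIV. coords (0, 1) $ i * D i u y)) * (1 + s)"
    by (simp add: left_diff_distrib)
  moreover have "\<beta> N N * (1 + s) = (\<Sum>i\<in>UNIV. \<Sum>j\<in>UNIV. D i u y * D j u y * A i j)"
  proof -
    have "\<beta> N N * (1 + s) = ((N \<bullet> N0) * (N \<bullet> N0) * (1 + s)) * (\<Sum>i\<in>UNIV. \<Sum>j\<in>UNIV. D i u y * D j u y * A i j)"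
      unfolding \<beta>N by (simp add: mult_ac)
    then show ?thesis unfolding height2 by simp
  qed
  ultimately show ?thesis by (simp add: A_def)
qed

end

lemma adapted_frame_exists:
  fixes N :: "('n::finite) ambient"
  assumes "norm N = 1"
  shows "\<exists>\<tau>. adapted_frame \<tau> N"
proof -
  have nz: "N \<noteq> 0" using assms by auto
  have "subspace {v. v \<bullet> N = 0}" using subspace_hyperplane[of N] by (simp add: inner_commute)
  moreover have "dim (UNIV :: (real^'n) set) = dim {v. v \<bullet> N = 0}"
    using dim_hyperplane[OF nz] by (simp add: inner_commute)
  ultimately obtain \<tau> where "linear \<tau>" "range \<tau> = {v. v \<bullet> N = 0}" "\<And>x::real^'n. norm (\<tau> x) = norm x"
    using isometry_subspaces[OF subspace_UNIV] by (metis UNIV_I)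
  then show ?thesis using assms by (intro exI[of _ \<tau>] adapted_frame.intro)
qed

section \<open>The curvature estimate\<close>

text \<open>First variation at the minimum t = 0. It shows that a unit vector maximising a quadratic
  form is an eigenvector.\<close>

lemma quadratic_nonneg_imp_linear_coeff_zero:
  fixes A C :: real
  assumes "\<And>t. 0 \<le> 2 * t * A + t * t * C"
  shows "A = 0"
proof -
  have "jet2 (\<lambda>t. 2 * t * A + t * t * C) 0 (2 * A) (2 * C)"
    by (rule jet2_eq, (rule jet2_intros)+) simp_all
  then have "2 * A = 0" by (rule jet2_local_min(1)) (use assms in simp)
  then show ?thesis by simp
qed

text \<open>By continuity the domain can be shrunk until the normal has a positive component along
  \<open>N0\<close>, which fixes the orientation. At the origin the normal is \<open>N0\<close>
  itself, so A is minus the Hessian of \<open>u\<close>.\<close>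

lemma (in adapted_frame) second_fundamental_form_local_graph:
  assumes \<Sigma>: "smooth_hypersurface \<Sigma>" "unit_normal_field \<Sigma> \<nu>" "p \<in> \<Sigma>" and N0: "N0 = \<nu> p"
  obtains B u where "open B" "0 \<in> B" "smooth_on u B" "u 0 = 0" "\<And>v. dird v u 0 = 0"
    "\<And>y. y \<in> B \<Longrightarrow> graph_map p u y \<in> \<Sigma>"
    "\<And>y. y \<in> B \<Longrightarrow> 0 < \<nu> (graph_map p u y) \<bullet> N0"
    "\<And>X Y. X \<bullet> N0 = 0 \<Longrightarrow> Y \<bullet> N0 = 0 \<Longrightarrow>
      second_fundamental_form \<Sigma> \<nu> p X Y = - dird (coords X) (dird (coords Y) u) 0"
proof -
  obtain B0 u where *: "open B0" "0 \<in> B0" "smooth_on u B0" "u 0 = 0" "\<And>v. dird v u 0 = 0"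
    "\<And>y. y \<in> B0 \<Longrightarrow> graph_map p u y \<in> \<Sigma>"
    using local_graph[OF \<Sigma> N0] by blast
  define B where "B = B0 \<inter> (\<lambda>y. \<nu> (graph_map p u y) \<bullet> N0) -` {0<..}"
  have g0: "graph_map p u 0 = p" using *(4) linear_0[OF linear_frame] by (simp add: graph_map_def)
  have "continuous_on B0 (\<lambda>y. \<nu> (graph_map p u y))"
    by (rule continuous_on_compose2[OF unit_normal_field_continuous[OF \<Sigma>(2)]
          smooth_on_continuous[OF smooth_on_graph_map[OF *(1,3)]]]) (use *(6) in auto)
  then have "continuous_on B0 (\<lambda>y. \<nu> (graph_map p u y) \<bullet> N0)" by (intro continuous_intros)
  then have B: "open B" unfolding B_def using *(1) by (intro continuous_open_preimage) auto
  have 0: "0 \<in> B" using *(2) g0 normal_normal by (simp add: B_def flip: N0)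
  have u: "smooth_on u B" by (rule smooth_on_subset[OF *(3)]) (simp add: B_def)
  have gB: "graph_map p u y \<in> \<Sigma>" "0 < \<nu> (graph_map p u y) \<bullet> N0" if "y \<in> B" for y
    using that *(6) by (auto simp: B_def)
  have T: "tangent_space \<Sigma> p = {v. v \<bullet> N0 = 0}"
    unfolding N0 by (rule tangent_space_eq_orthogonal[OF \<Sigma>])
  have "second_fundamental_form \<Sigma> \<nu> p X Y = - dird (coords X) (dird (coords Y) u) 0"
    if "X \<bullet> N0 = 0" "Y \<bullet> N0 = 0" for X Y
    using graph_second_fundamental_form[OF \<Sigma>(1,2) B u gB 0, of X Y] that T g0 normal_normal
    by (simp flip: N0)
  then show thesis using that[OF B 0 u *(4,5) gB] by blast
qed

text \<open>Symmetry is that of the Hessian in a local graph. Extending by \<open>coords\<close> to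
  all ambient vectors gives a form that is \<open>bilinear\<close> in the library sense.\<close>

lemma second_fundamental_form_bilinear:
  fixes \<Sigma> :: "('n::finite) ambient set"
  assumes \<Sigma>: "smooth_hypersurface \<Sigma>" "unit_normal_field \<Sigma> \<nu>" "p \<in> \<Sigma>"
  obtains \<beta> where "bilinear \<beta>" "\<And>X Y. \<beta> X Y = \<beta> Y X"
    "\<And>X Y. X \<bullet> \<nu> p = 0 \<Longrightarrow> Y \<bullet> \<nu> p = 0 \<Longrightarrow> second_fundamental_form \<Sigma> \<nu> p X Y = \<beta> X Y"
proof -
  have "norm (\<nu> p) = 1" using \<Sigma>(2,3) unfolding unit_normal_field_def by blast
  then obtain \<tau> where "adapted_frame \<tau> (\<nu> p)" using adapted_frame_exists by blast
  then interpret adapted_frame \<tau> "\<nu> p" .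
  obtain B u where *: "open B" "0 \<in> B" "smooth_on u B"
    "\<And>X Y. X \<bullet> \<nu> p = 0 \<Longrightarrow> Y \<bullet> \<nu> p = 0 \<Longrightarrow>
      second_fundamental_form \<Sigma> \<nu> p X Y = - dird (coords X) (dird (coords Y) u) 0"
    using second_fundamental_form_local_graph[OF \<Sigma> refl] by metis
  define \<beta> where "\<beta> X Y = - dird (coords X) (dird (coords Y) u) 0" for X Y
  have sym: "\<beta> X Y = \<beta> Y X" for X Y
    unfolding \<beta>_def using dird_commute[OF *(1-3)] by simp
  have "linear (\<lambda>X. \<beta> X Y)" for Y
  proof -
    have "linear ((\<lambda>v. dird v (dird (coords Y) u) 0) \<circ> coords)"
      by (intro linear_compose linear_coords linear_dird smooth_on_differentiable[OF smooth_on_dird[OF *(3)] *(2)])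
    then show ?thesis unfolding \<beta>_def by (simp add: linear_iff)
  qed
  then have "bilinear \<beta>" unfolding bilinear_def using sym by (metis ext)
  then show thesis by (rule that[OF _ sym]) (simp add: *(4) \<beta>_def)
qed

text \<open>The maximality is used twice: at \<open>p\<close>, where it makes \<open>X\<close> a
  principal direction, and at nearby points, where it becomes the differential inequality for the
  graph function.\<close>

lemma maximum_point_estimate:
  fixes \<Sigma> :: "('n::finite) ambient set"
  assumes tr: "translator \<Sigma> \<nu>" and p: "p \<in> \<Sigma>" and R: "0 < R" and V: "norm V = 1"
    and a: "0 < a" "a < V \<bullet> \<nu> p"
    and \<eta>0: "0 < R\<^sup>2 - (norm (p - x0))\<^sup>2"
    and X: "X \<bullet> \<nu> p = 0" "norm X = 1" and \<kappa>: "second_fundamental_form \<Sigma> \<nu> p X X \<noteq> 0"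
    and M: "M * (V \<bullet> \<nu> p - a) = (R\<^sup>2 - (norm (p - x0))\<^sup>2) * \<bar>second_fundamental_form \<Sigma> \<nu> p X X\<bar>"
    and max: "\<And>q Y. q \<in> \<Sigma> \<inter> cball x0 R \<Longrightarrow> Y \<bullet> \<nu> q = 0 \<Longrightarrow>
      (R\<^sup>2 - (norm (q - x0))\<^sup>2) * \<bar>second_fundamental_form \<Sigma> \<nu> q Y Y\<bar> \<le> M * (V \<bullet> \<nu> q - a) * (Y \<bullet> Y)"
  shows "((R\<^sup>2 - (norm (p - x0))\<^sup>2) * \<bar>second_fundamental_form \<Sigma> \<nu> p X X\<bar>)\<^sup>2
    \<le> 2 / a * R\<^sup>2 * (8 / a + 8 + 2 * real CARD('n) + 2 * R)"
proof -
  have \<Sigma>: "smooth_hypersurface \<Sigma>" "unit_normal_field \<Sigma> \<nu>" using tr unfolding translator_def by auto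
  have "norm (\<nu> p) = 1" using \<Sigma>(2) p unfolding unit_normal_field_def by blast
  then obtain \<tau> where "adapted_frame \<tau> (\<nu> p)" using adapted_frame_exists by blast
  then interpret adapted_frame \<tau> "\<nu> p" .
  obtain B0 u where B0: "open B0" "0 \<in> B0" "smooth_on u B0" and u0: "u 0 = 0" "\<And>v. dird v u 0 = 0"
    and graph0: "\<And>y. y \<in> B0 \<Longrightarrow> graph_map p u y \<in> \<Sigma>"
    "\<And>y. y \<in> B0 \<Longrightarrow> 0 < \<nu> (graph_map p u y) \<bullet> \<nu> p"
    and sff: "\<And>X Y. X \<bullet> \<nu> p = 0 \<Longrightarrow> Y \<bullet> \<nu> p = 0 \<Longrightarrow>
      second_fundamental_form \<Sigma> \<nu> p X Y = - dird (coords X) (dird (coords Y) u) 0"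
    using second_fundamental_form_local_graph[OF \<Sigma> p refl] by metis
  have g0: "graph_map p u 0 = p" using u0(1) linear_0[OF linear_frame] by (simp add: graph_map_def)
  have pin: "p \<in> ball x0 R"
    using \<eta>0 R by (simp add: dist_norm norm_minus_commute power2_less_imp_less)
  \<comment> \<open>Positivity of \<eta> puts \<open>p\<close> in the open ball, so nearby graph
    points still compete in the maximum.\<close>
  define B where "B = B0 \<inter> graph_map p u -` ball x0 R"
  have B: "open B" "0 \<in> B"
    unfolding B_def
    using continuous_open_preimage[OF smooth_on_continuous[OF smooth_on_graph_map[OF B0(1,3)]] B0(1) open_ball]
      B0(2) g0 pin by auto
  have u: "smooth_on u B" by (rule smooth_on_subset[OF B0(3)]) (simp add: B_def)
  have graph: "graph_map p u y \<in> \<Sigma>" "0 < \<nu> (graph_map p u y) \<bullet> \<nu> p" "graph_map p u y \<in> ball x0 R"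
    if "y \<in> B" for y
    using that graph0 by (auto simp: B_def)
  define \<xi> where "\<xi> = coords X"
  have X\<xi>: "X = \<tau> \<xi>" using frame_decomposition[of X] X(1) by (simp add: \<xi>_def)
  have \<xi>: "norm \<xi> = 1" using X(2) norm_frame by (simp add: X\<xi>)
  define \<kappa> where "\<kappa> = \<bar>second_fundamental_form \<Sigma> \<nu> p X X\<bar>"
  define \<sigma> where "\<sigma> = sgn (dird \<xi> (dird \<xi> u) 0)"
  define \<eta>0 where "\<eta>0 = R\<^sup>2 - (norm (p - x0))\<^sup>2"
  define b where "b v w = dird v (dird w u) 0" for v w
  have b\<xi>: "b \<xi> \<xi> \<noteq> 0" "\<kappa> = \<bar>b \<xi> \<xi>\<bar>"
    using \<kappa> sff[OF X(1) X(1)] by (auto simp: \<kappa>_def b_def \<xi>_def)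
  have \<kappa>pos: "0 < \<kappa>" and \<sigma>\<sigma>: "\<sigma> * \<sigma> = 1" and \<sigma>b: "\<sigma> * b \<xi> \<xi> = \<kappa>"
    using b\<xi> by (auto simp: \<sigma>_def b_def sgn_if)
  have blin: "linear (\<lambda>v. b v w)" for w
    unfolding b_def by (rule linear_dird[OF smooth_on_differentiable[OF smooth_on_dird[OF u] B(2)]])
  have bsym: "b v w = b w v" for v w
    unfolding b_def by (rule dird_commute[OF B u])
  have d: "0 < V \<bullet> \<nu> p - a" using a by simp
  have bmax: "\<sigma> * b v v \<le> \<kappa> * (v \<bullet> v)" for v
  proof -
    have "\<eta>0 * \<bar>b v v\<bar> \<le> M * (V \<bullet> \<nu> p - a) * (v \<bullet> v)"
      using max[of p "\<tau> v"] p pin sff[of "\<tau> v" "\<tau> v"] by (simp add: \<eta>0_def b_def inner_frame)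
    then have "\<eta>0 * \<bar>b v v\<bar> \<le> \<eta>0 * (\<kappa> * (v \<bullet> v))"
      unfolding M by (simp add: \<eta>0_def \<kappa>_def)
    then have "\<bar>b v v\<bar> \<le> \<kappa> * (v \<bullet> v)" using \<open>0 < R\<^sup>2 - (norm (p - x0))\<^sup>2\<close> by (simp add: \<eta>0_def)
    moreover have "\<sigma> * b v v \<le> \<bar>b v v\<bar>"
      using abs_ge_self[of "b v v"] abs_ge_minus_self[of "b v v"] by (simp add: \<sigma>_def sgn_if)
    ultimately show ?thesis by linarith
  qed
  \<comment> \<open>By \<open>bmax\<close> the form \<open>\<sigma> * b\<close> attains its maximum
    \<kappa> over unit vectors at \<open>\<xi>\<close>; varying \<open>\<xi>\<close> in an arbitrary
    direction \<open>v\<close> gives the eigenvalue equation.\<close>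
  have eig: "b v \<xi> = \<sigma> * \<kappa> * (\<xi> \<bullet> v)" for v
  proof -
    have "0 \<le> 2 * t * (\<kappa> * (\<xi> \<bullet> v) - \<sigma> * b v \<xi>) + t * t * (\<kappa> * (v \<bullet> v) - \<sigma> * b v v)" for t
    proof -
      have "b (\<xi> + t *\<^sub>R v) (\<xi> + t *\<^sub>R v) = b \<xi> (\<xi> + t *\<^sub>R v) + t * b v (\<xi> + t *\<^sub>R v)"
        using linear_add[OF blin] linear_cmul[OF blin] by simp
      also have "\<dots> = b \<xi> \<xi> + t * b v \<xi> + t * (b v \<xi> + t * b v v)"
        unfolding bsym[of _ "\<xi> + t *\<^sub>R v"] using linear_add[OF blin] linear_cmul[OF blin] bsym by simp
      finally have 1: "\<sigma> * b (\<xi> + t *\<^sub>R v) (\<xi> + t *\<^sub>R v) = \<kappa> + 2 * t * (\<sigma> * b v \<xi>) + t * t * (\<sigma> * b v v)"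
        using \<sigma>b by (simp add: algebra_simps)
      have 2: "\<kappa> * ((\<xi> + t *\<^sub>R v) \<bullet> (\<xi> + t *\<^sub>R v)) = \<kappa> + 2 * t * (\<kappa> * (\<xi> \<bullet> v)) + t * t * (\<kappa> * (v \<bullet> v))"
        using \<xi> by (simp add: inner_add_left inner_add_right norm_eq_1 inner_commute algebra_simps)
      show ?thesis using bmax[of "\<xi> + t *\<^sub>R v"] unfolding 1 2 by (simp add: algebra_simps)
    qed
    then have "\<kappa> * (\<xi> \<bullet> v) - \<sigma> * b v \<xi> = 0"
      by (rule quadratic_nonneg_imp_linear_coeff_zero)
    then have "\<sigma> * (\<sigma> * b v \<xi>) = \<sigma> * (\<kappa> * (\<xi> \<bullet> v))" by simp
    then show ?thesis using \<sigma>\<sigma> by (simp add: mult.assoc[symmetric])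
  qed
  define c where "c = coords (p - x0)"
  define cn where "cn = (p - x0) \<bullet> \<nu> p"
  have coords_graph: "(norm (graph_map p u y - x0))\<^sup>2 = (c + y) \<bullet> (c + y) + (cn + u y) * (cn + u y)" for y
  proof -
    have "coords (\<nu> p) = 0" by (simp add: coords_def vec_eq_iff)
    then have "coords (graph_map p u y - x0) = c + y"
      unfolding graph_map_def c_def
      by (simp add: linear_add[OF linear_coords] linear_diff[OF linear_coords] linear_cmul[OF linear_coords])
    moreover have "(graph_map p u y - x0) \<bullet> \<nu> p = cn + u y"
      by (simp add: graph_map_def cn_def inner_add_left inner_diff_left)
    ultimately show ?thesis
      using inner_decomposition[of "graph_map p u y - x0" "graph_map p u y - x0"] by (simp add: power2_norm_eq_inner)
  qed
  have \<eta>c: "\<eta>0 = R\<^sup>2 - (c \<bullet> c + cn * cn)"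
    using coords_graph[of 0] g0 u0(1) by (simp add: \<eta>0_def)
  have VV: "(norm (coords V))\<^sup>2 + (V \<bullet> \<nu> p)\<^sup>2 = 1"
    using inner_decomposition[of V V] V
    unfolding power2_norm_eq_inner power2_eq_square[of "V \<bullet> \<nu> p"] by (simp add: norm_eq_1)
  have V1: "norm (coords V) \<le> 1"
  proof (rule power2_le_imp_le)
    show "(norm (coords V))\<^sup>2 \<le> 1\<^sup>2" using VV zero_le_power2[of "V \<bullet> \<nu> p"] unfolding one_power2 by linarith
  qed simp
  have V2: "V \<bullet> \<nu> p - a \<le> 1"
  proof -
    have "V \<bullet> \<nu> p \<le> norm V * norm (\<nu> p)" by (rule norm_cauchy_schwarz)
    then show ?thesis using V norm_normal a(1) by simp
  qed
  have ce: "((0, 1) \<bullet> \<nu> p) * cn + coords (0, 1) \<bullet> c \<le> R"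
  proof -
    have "((0, 1) \<bullet> \<nu> p) * cn + coords (0, 1) \<bullet> c = (0, 1) \<bullet> (p - x0)"
      using inner_decomposition[of "(0, 1)" "p - x0"] by (simp add: c_def cn_def)
    also have "\<dots> \<le> norm ((0::real^'n, 1::real)) * norm (p - x0)" by (rule norm_cauchy_schwarz)
    also have "\<dots> \<le> R" using pin by (simp add: dist_norm norm_minus_commute)
    finally show ?thesis .
  qed
  have ineq: "\<sigma> * (R\<^sup>2 - ((c + y) \<bullet> (c + y) + (cn + u y) * (cn + u y))) * dird \<xi> (dird \<xi> u) y
        \<le> M * (V \<bullet> \<nu> p - (\<Sum>i\<in>UNIV. coords V $ i * dird (axis i 1) u y)
             - a * sqrt (1 + (\<Sum>i\<in>UNIV. dird (axis i 1) u y * dird (axis i 1) u y)))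
           * (1 + dird \<xi> u y * dird \<xi> u y)" if y: "y \<in> B" for y
  proof -
    define q where "q = graph_map p u y"
    define N where "N = \<nu> q"
    \<comment> \<open>The fixed direction \<open>\<xi>\<close> lifted to the tangent plane at
      \<open>q\<close>. It is left unnormalised, and its squared length is the last factor of the
      inequality.\<close>
    define Y where "Y = \<tau> \<xi> + dird \<xi> u y *\<^sub>R \<nu> p"
    define s where "s = (\<Sum>i\<in>UNIV. dird (axis i 1) u y * dird (axis i 1) u y)"
    define W where "W = sqrt (1 + s)"
    note G = graph_geometry[OF \<Sigma> B(1) u graph(1,2) y]
    have s0: "0 \<le> s" unfolding s_def by (intro sum_nonneg) simp
    have W0: "0 < W" using s0 by (simp add: W_def)
    have height: "N \<bullet> \<nu> p = 1 / W" using G(2) by (simp add: N_def q_def W_def s_def)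
    have qq: "q \<in> \<Sigma> \<inter> cball x0 R" using graph(1,3)[OF y] by (auto simp: q_def)
    have "tangent_space \<Sigma> q = range (\<lambda>v. \<tau> v + dird v u y *\<^sub>R \<nu> p)"
      unfolding q_def by (rule G(3))
    then have YT: "Y \<in> tangent_space \<Sigma> q" unfolding Y_def by blast
    have YN: "Y \<bullet> N = 0"
      unfolding N_def using unit_normal_field_orthogonal[OF \<Sigma>(2) _ YT] qq by blast
    have "coords (\<nu> p) = 0" by (simp add: coords_def vec_eq_iff)
    then have cY: "coords Y = \<xi>"
      unfolding Y_def by (simp add: linear_add[OF linear_coords] linear_cmul[OF linear_coords])
    have YY: "Y \<bullet> Y = 1 + dird \<xi> u y * dird \<xi> u y"
      using \<xi> by (simp add: Y_def inner_add_left inner_add_right inner_frame norm_eq_1)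
    have h: "second_fundamental_form \<Sigma> \<nu> q Y Y = - dird \<xi> (dird \<xi> u) y / W"
      using G(4)[of Y Y] YT height by (simp add: q_def N_def cY)
    have w: "V \<bullet> N = (V \<bullet> \<nu> p - (\<Sum>i\<in>UNIV. coords V $ i * dird (axis i 1) u y)) / W"
    proof -
      have "coords N $ i = - dird (axis i 1) u y / W" for i
        using G(1)[of "axis i 1"] height by (simp add: coords_def N_def q_def)
      then show ?thesis
        using inner_decomposition[of V N] height
        by (simp add: inner_vec_def sum_negf sum_divide_distrib diff_divide_distrib)
    qed
    define f where "f = dird \<xi> (dird \<xi> u) y"
    define E where "E = R\<^sup>2 - (norm (q - x0))\<^sup>2"
    have E0: "0 \<le> E"
    proof -
      have "norm (q - x0) \<le> R" using qq by (simp add: dist_norm norm_minus_commute)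
      then have "(norm (q - x0))\<^sup>2 \<le> R\<^sup>2" by (intro power_mono) auto
      then show ?thesis by (simp add: E_def)
    qed
    have "E * (\<bar>f\<bar> / W) \<le> M * (V \<bullet> N - a) * (Y \<bullet> Y)"
      using max[OF qq YN[unfolded N_def]] h W0 by (simp add: E_def N_def f_def abs_divide)
    \<comment> \<open>Multiplying by W clears the denominators of A(Y, Y) and of the inner product
      of V and N; only the constant \<open>a\<close> keeps a factor W.\<close>
    then have "E * (\<bar>f\<bar> / W) * W \<le> M * (V \<bullet> N - a) * (Y \<bullet> Y) * W"
      using W0 by (intro mult_right_mono) auto
    then have "E * \<bar>f\<bar> \<le> M * ((V \<bullet> N - a) * W) * (Y \<bullet> Y)"
      using W0 by (simp add: mult_ac)
    also have "(V \<bullet> N - a) * W = V \<bullet> \<nu> p - (\<Sum>i\<in>UNIV. coords V $ i * dird (axis i 1) u y) - a * W"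
      unfolding left_diff_distrib[of "V \<bullet> N"]
        iffD1[OF nonzero_eq_divide_eq w, OF less_imp_neq[OF W0, symmetric]] ..
    finally have "E * \<bar>f\<bar> \<le> M * (V \<bullet> \<nu> p - (\<Sum>i\<in>UNIV. coords V $ i * dird (axis i 1) u y) - a * W) * (Y \<bullet> Y)" .
    \<comment> \<open>The sign \<sigma> is frozen at \<open>p\<close>; where the curvature at
      \<open>q\<close> has the other sign, the signed quantity is only smaller.\<close>
    moreover have "\<sigma> * E * f \<le> E * \<bar>f\<bar>"
    proof -
      have "\<sigma> * f \<le> \<bar>f\<bar>"
        using abs_ge_self[of f] abs_ge_minus_self[of f] by (simp add: \<sigma>_def sgn_if)
      then have "E * (\<sigma> * f) \<le> E * \<bar>f\<bar>" using E0 by (rule mult_left_mono)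
      then show ?thesis by (simp add: mult_ac)
    qed
    ultimately show ?thesis
      unfolding E_def f_def YY W_def s_def q_def coords_graph by linarith
  qed
  have "(\<eta>0 * \<kappa>)\<^sup>2 \<le> 2 / a * R\<^sup>2 * (8 / a + 8 + 2 * real CARD('n) + 2 * R)"
  proof (rule graph_interior_estimate[OF B u u0 _ \<sigma>\<sigma> \<xi> \<kappa>pos _ \<eta>c _ R a V2 V1 ce _ ineq])
    show "dird v (dird \<xi> u) 0 = \<sigma> * \<kappa> * (\<xi> \<bullet> v)" for v
      using eig[of v] by (simp add: b_def)
    show "0 < \<eta>0" using \<open>0 < R\<^sup>2 - (norm (p - x0))\<^sup>2\<close> by (simp add: \<eta>0_def)
    show "M * (V \<bullet> \<nu> p - a) = \<eta>0 * \<kappa>" using M by (simp add: \<eta>0_def \<kappa>_def)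
  next
    fix y assume "y \<in> B"
    from graph_translator_equation[OF tr B(1) u graph(1,2) this]
    show "(\<Sum>i\<in>UNIV. dird (axis i 1) (dird (axis i 1) u) y) * (1 + (\<Sum>i\<in>UNIV. dird (axis i 1) u y * dird (axis i 1) u y))
        - (\<Sum>i\<in>UNIV. \<Sum>j\<in>UNIV. dird (axis i 1) u y * dird (axis j 1) u y * dird (axis i 1) (dird (axis j 1) u) y)
        = ((0, 1) \<bullet> \<nu> p - (\<Sum>i\<in>UNIV. coords (0, 1) $ i * dird (axis i 1) u y))
          * (1 + (\<Sum>i\<in>UNIV. dird (axis i 1) u y * dird (axis i 1) u y))" .
  qed
  then show ?thesis by (simp add: \<eta>0_def \<kappa>_def)
qed

section \<open>Existence of the maximum and the global bound\<close>

lemma compact_properly_embedded_Int_cball: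
  fixes \<Sigma> :: "('n::finite) ambient set"
  assumes "properly_embedded \<Sigma>"
  shows "compact (\<Sigma> \<inter> cball x0 R)"
proof -
  have "compactin (top_of_set \<Sigma>) {x \<in> topspace (top_of_set \<Sigma>). x \<in> cball x0 R}"
    using assms unfolding properly_embedded_def
    by (intro compactin_proper_map_preimage[where f = "\<lambda>x. x"]) (auto simp: compactin_euclidean_iff)
  moreover have "{x \<in> topspace (top_of_set \<Sigma>). x \<in> cball x0 R} = \<Sigma> \<inter> cball x0 R" by auto
  ultimately have "compactin (top_of_set \<Sigma>) (\<Sigma> \<inter> cball x0 R)" by simp
  then show ?thesis by (simp add: compactin_subtopology)
qed

text \<open>The maximum is taken over pairs, so continuity must be joint in point and vector.
  Expanding the direction of differentiation of a smooth extension in the standard basis separates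
  the two.\<close>

lemma second_fundamental_form_continuous:
  fixes \<Sigma> :: "('n::finite) ambient set"
  assumes \<Sigma>: "smooth_hypersurface \<Sigma>" "unit_normal_field \<Sigma> \<nu>"
  shows "continuous_on {(q, Y). q \<in> \<Sigma> \<and> Y \<bullet> \<nu> q = 0} (\<lambda>(q, Y). second_fundamental_form \<Sigma> \<nu> q Y Y)"
    (is "continuous_on ?K ?h")
  unfolding continuous_on_eq_continuous_within
proof (intro ballI)
  fix z assume z: "z \<in> ?K"
  have zS: "fst z \<in> \<Sigma>" using z by auto
  obtain W F where *: "open W" "fst z \<in> W" "smooth_on F W"
    "\<And>q X. q \<in> \<Sigma> \<inter> W \<Longrightarrow> X \<in> tangent_space \<Sigma> q \<Longrightarrow> tangential_derivative \<Sigma> \<nu> q X = dird X F q"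
    using unit_normal_field_extension[OF \<Sigma>(2) zS] by metis
  define G where "G z = (\<Sum>b\<in>Basis. (snd z \<bullet> b) * (dird b F (fst z) \<bullet> snd z))" for z :: "'n ambient \<times> 'n ambient"
  have "continuous_on (W \<times> UNIV) (\<lambda>z. dird b F (fst z))" for b
    by (rule continuous_on_compose2[OF smooth_on_continuous[OF smooth_on_dird[OF *(3)]]])
      (auto intro: continuous_on_fst continuous_on_id)
  then have "continuous_on (W \<times> UNIV) G"
    unfolding G_def by (intro continuous_intros)
  moreover have zW: "open (W \<times> UNIV)" "z \<in> W \<times> UNIV" using *(1,2) by (auto intro: open_Times simp: mem_Times_iff)
  ultimately have "isCont G z"
    using continuous_on_eq_continuous_at by blast
  then have G: "continuous (at z within ?K) G"
    by (rule continuous_at_imp_continuous_at_within)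
  obtain d where d: "d > 0" "ball z d \<subseteq> W \<times> UNIV" using zW openE by blast
  have eq: "G z' = ?h z'" if z': "z' \<in> ?K" "dist z' z < d" for z'
  proof -
    obtain q Y where qY: "z' = (q, Y)" "q \<in> \<Sigma>" "Y \<bullet> \<nu> q = 0" using z' by auto
    have "z' \<in> ball z d" using z'(2) by (simp add: dist_commute)
    then have "z' \<in> W \<times> UNIV" using d(2) by blast
    then have q: "q \<in> \<Sigma> \<inter> W" using qY by simp
    have Y: "Y \<in> tangent_space \<Sigma> q" using tangent_space_eq_orthogonal[OF \<Sigma> qY(2)] qY(3) by simp
    have lin: "linear (\<lambda>X. dird X F q)"
      using q by (intro linear_dird smooth_on_differentiable[OF *(3)]) simp
    have "dird Y F q = dird (\<Sum>b\<in>Basis. (Y \<bullet> b) *\<^sub>R b) F q"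
      by (simp add: euclidean_representation)
    also have "\<dots> = (\<Sum>b\<in>Basis. (Y \<bullet> b) *\<^sub>R dird b F q)"
      using linear_sum[OF lin, of "\<lambda>b. (Y \<bullet> b) *\<^sub>R b" Basis] linear_cmul[OF lin] by simp
    finally show ?thesis
      using *(4)[OF q Y] by (simp add: second_fundamental_form_def G_def qY(1) inner_sum_left)
  qed
  show "continuous (at z within ?K) ?h"
    by (rule continuous_transform_within[OF G d(1) z]) (use eq in blast)
qed

text \<open>Polarisation carries the bound \<open>L\<close> from the quadratic form to every entry
  in an orthonormal basis; there are n^2 entries.\<close>

lemma norm_second_fundamental_form_le:
  fixes \<Sigma> :: "('n::finite) ambient set"
  assumes \<Sigma>: "smooth_hypersurface \<Sigma>" "unit_normal_field \<Sigma> \<nu>" "p \<in> \<Sigma>"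
    and L: "\<And>Y. Y \<bullet> \<nu> p = 0 \<Longrightarrow> \<bar>second_fundamental_form \<Sigma> \<nu> p Y Y\<bar> \<le> L * (Y \<bullet> Y)"
  shows "(norm_second_fundamental_form \<Sigma> \<nu> p)\<^sup>2 \<le> (real CARD('n))\<^sup>2 * L\<^sup>2"
proof -
  define h where "h = second_fundamental_form \<Sigma> \<nu> p"
  define T where "T = tangent_basis \<Sigma> p"
  obtain \<beta> where \<beta>: "bilinear \<beta>" "\<And>X Y. \<beta> X Y = \<beta> Y X"
    "\<And>X Y. X \<bullet> \<nu> p = 0 \<Longrightarrow> Y \<bullet> \<nu> p = 0 \<Longrightarrow> h X Y = \<beta> X Y"
    using second_fundamental_form_bilinear[OF \<Sigma>] unfolding h_def by metis
  have ob: "\<And>b. b \<in> T \<Longrightarrow> norm b = 1" "finite T" "card T = CARD('n)" "\<And>b. b \<in> T \<Longrightarrow> b \<bullet> \<nu> p = 0"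
    using orthonormal_basis_of_tangent_basis[OF \<Sigma>] tangent_space_eq_orthogonal[OF \<Sigma>]
    unfolding orthonormal_basis_of_def T_def by auto
  have "\<bar>h b c\<bar> \<le> L" if bc: "b \<in> T" "c \<in> T" for b c
  proof -
    have orth: "(b + c) \<bullet> \<nu> p = 0" "(b - c) \<bullet> \<nu> p = 0"
      using ob(4) bc by (auto simp: inner_add_left inner_diff_left)
    have "4 * h b c = h (b + c) (b + c) - h (b - c) (b - c)"
      using \<beta>(3) orth ob(4) bc \<beta>(2)[of c b]
      by (simp add: bilinear_ladd[OF \<beta>(1)] bilinear_radd[OF \<beta>(1)] bilinear_lsub[OF \<beta>(1)] bilinear_rsub[OF \<beta>(1)])
    then have "4 * \<bar>h b c\<bar> \<le> \<bar>h (b + c) (b + c)\<bar> + \<bar>h (b - c) (b - c)\<bar>"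
      by linarith
    also have "\<dots> \<le> L * ((b + c) \<bullet> (b + c)) + L * ((b - c) \<bullet> (b - c))"
      using L orth unfolding h_def by (intro add_mono) auto
    also have "\<dots> = 2 * L * (b \<bullet> b + c \<bullet> c)"
      by (simp add: inner_add_left inner_add_right inner_diff_left inner_diff_right inner_commute algebra_simps)
    also have "\<dots> = 4 * L" using ob(1) bc by (simp add: norm_eq_1)
    finally show ?thesis by simp
  qed
  then have "(h b c)\<^sup>2 \<le> L\<^sup>2" if "b \<in> T" "c \<in> T" for b c
    using that by (simp add: abs_le_square_iff[symmetric]) (meson abs_ge_self order_trans)
  then have "(\<Sum>b\<in>T. \<Sum>c\<in>T. (h b c)\<^sup>2) \<le> (\<Sum>b\<in>T. \<Sum>c\<in>T. L\<^sup>2)"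
    by (intro sum_mono)
  moreover have "(norm_second_fundamental_form \<Sigma> \<nu> p)\<^sup>2 = (\<Sum>b\<in>T. \<Sum>c\<in>T. (h b c)\<^sup>2)"
    unfolding norm_second_fundamental_form_def h_def T_def by (simp add: sum_nonneg)
  ultimately show ?thesis using ob(3) by (simp add: power2_eq_square)
qed

text \<open>The maximal value bounds the weighted curvature at every point; homogeneity extends this
  from unit vectors to all, and the estimate at the maximum point bounds the maximal value by
  quantities free of \<open>\<Sigma>\<close>.\<close>

lemma weighted_curvature_maximum:
  fixes \<Sigma> :: "('n::finite) ambient set"
  assumes emb: "properly_embedded \<Sigma>" and tr: "translator \<Sigma> \<nu>" and R: "0 < R" and V: "norm V = 1"
    and \<delta>: "0 < \<delta>" "\<And>x. x \<in> \<Sigma> \<inter> cball x0 R \<Longrightarrow> \<delta> \<le> V \<bullet> \<nu> x"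
    and q: "q \<in> \<Sigma> \<inter> cball x0 R" and Y: "Y \<bullet> \<nu> q = 0"
  defines "a \<equiv> \<delta> / 2"
  shows "(R\<^sup>2 - (norm (q - x0))\<^sup>2) * \<bar>second_fundamental_form \<Sigma> \<nu> q Y Y\<bar>
    \<le> sqrt (2 / a * R\<^sup>2 * (8 / a + 8 + 2 * real CARD('n) + 2 * R)) / a * (V \<bullet> \<nu> q - a) * (Y \<bullet> Y)"
proof -
  have \<Sigma>: "smooth_hypersurface \<Sigma>" "unit_normal_field \<Sigma> \<nu>" using tr unfolding translator_def by auto
  define h where "h q Y = second_fundamental_form \<Sigma> \<nu> q Y Y" for q Y
  define K where "K = {(q, Y). q \<in> \<Sigma> \<inter> cball x0 R \<and> Y \<bullet> \<nu> q = 0 \<and> norm Y = 1}"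
  define \<Phi> where "\<Phi> z = (R\<^sup>2 - (norm (fst z - x0))\<^sup>2) * \<bar>h (fst z) (snd z)\<bar> / (V \<bullet> \<nu> (fst z) - a)" for z
  have hscale: "h q (t *\<^sub>R Y) = t * t * h q Y" if qY: "q \<in> \<Sigma>" "Y \<bullet> \<nu> q = 0" for q Y t
  proof -
    obtain \<beta> where \<beta>: "bilinear \<beta>"
      "\<And>X Y. X \<bullet> \<nu> q = 0 \<Longrightarrow> Y \<bullet> \<nu> q = 0 \<Longrightarrow> second_fundamental_form \<Sigma> \<nu> q X Y = \<beta> X Y"
      using second_fundamental_form_bilinear[OF \<Sigma> qY(1)] by metis
    then show ?thesis
      unfolding h_def using qY(2) by (simp add: bilinear_lmul[OF \<beta>(1)] bilinear_rmul[OF \<beta>(1)])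
  qed
  have a: "0 < a" using \<delta>(1) by (simp add: a_def)
  have wa: "a \<le> V \<bullet> \<nu> x - a" if "x \<in> \<Sigma> \<inter> cball x0 R" for x
    using \<delta>(2)[OF that] by (simp add: a_def)
  have h0: "0 \<le> R\<^sup>2 - (norm (x - x0))\<^sup>2" if "x \<in> cball x0 R" for x
    using that by (simp add: dist_norm norm_minus_commute power_mono)
  have contN: "continuous_on (\<Sigma> \<inter> cball x0 R) \<nu>"
    using unit_normal_field_continuous[OF \<Sigma>(2)] continuous_on_subset by blast
  have "compact K"
  proof -
    let ?P = "(\<Sigma> \<inter> cball x0 R) \<times> sphere (0::'n ambient) 1"
    have cP: "compact ?P"
      by (intro compact_Times compact_properly_embedded_Int_cball[OF emb] compact_sphere)
    have "continuous_on ?P (\<lambda>z. \<nu> (fst z))"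
      by (rule continuous_on_compose2[OF contN]) (auto intro: continuous_on_fst continuous_on_id)
    then have "continuous_on ?P (\<lambda>z. snd z \<bullet> \<nu> (fst z))"
      by (intro continuous_intros)
    then have "closed (?P \<inter> (\<lambda>z. snd z \<bullet> \<nu> (fst z)) -` {0})"
      using compact_imp_closed[OF cP] by (intro continuous_closed_preimage) auto
    then have "compact (?P \<inter> (?P \<inter> (\<lambda>z. snd z \<bullet> \<nu> (fst z)) -` {0}))"
      using cP by (rule compact_Int_closed[rotated])
    moreover have "?P \<inter> (?P \<inter> (\<lambda>z. snd z \<bullet> \<nu> (fst z)) -` {0}) = K"
      by (auto simp: K_def)
    ultimately show ?thesis by simp
  qed
  moreover have "continuous_on K \<Phi>"
  proof -
    have 1: "continuous_on K (\<lambda>z. \<nu> (fst z))"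
      by (rule continuous_on_compose2[OF contN]) (auto simp: K_def intro: continuous_on_fst continuous_on_id)
    have "continuous_on K (\<lambda>(q, Y). second_fundamental_form \<Sigma> \<nu> q Y Y)"
      by (rule continuous_on_subset[OF second_fundamental_form_continuous[OF \<Sigma>]]) (auto simp: K_def)
    then have 2: "continuous_on K (\<lambda>z. h (fst z) (snd z))" by (simp add: h_def case_prod_unfold)
    show ?thesis unfolding \<Phi>_def
      by (intro continuous_intros 1 2) (use a wa in \<open>fastforce simp: K_def\<close>)
  qed
  ultimately have ex: "K \<noteq> {} \<Longrightarrow> \<exists>z\<in>K. \<forall>z'\<in>K. \<Phi> z' \<le> \<Phi> z"
    using continuous_attains_sup by blast
  show ?thesis
  proof (cases "Y = 0")
    case True
    then show ?thesis using hscale[of q 0 0] q by (simp add: h_def)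
  next
    case False
    define Y1 where "Y1 = inverse (norm Y) *\<^sub>R Y"
    have Y1: "Y1 \<bullet> \<nu> q = 0" "norm Y1 = 1" "Y = norm Y *\<^sub>R Y1" using False Y by (auto simp: Y1_def)
    have qK: "(q, Y1) \<in> K" using q Y1 by (simp add: K_def)
    obtain p X where pX: "(p, X) \<in> K" and max: "\<And>z. z \<in> K \<Longrightarrow> \<Phi> z \<le> \<Phi> (p, X)"
      using ex qK by fast
    have p: "p \<in> \<Sigma> \<inter> cball x0 R" "X \<bullet> \<nu> p = 0" "norm X = 1" using pX by (auto simp: K_def)
    define M where "M = \<Phi> (p, X)"
    define m where "m = (R\<^sup>2 - (norm (p - x0))\<^sup>2) * \<bar>h p X\<bar>"
    define Z where "Z = 2 / a * R\<^sup>2 * (8 / a + 8 + 2 * real CARD('n) + 2 * R)"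
    have m0: "0 \<le> m" using h0[of p] p(1) by (simp add: m_def)
    have wp: "a \<le> V \<bullet> \<nu> p - a" using wa[OF p(1)] .
    have Mm: "M * (V \<bullet> \<nu> p - a) = m" using wp a by (simp add: M_def \<Phi>_def m_def)
    have bound: "(R\<^sup>2 - (norm (x - x0))\<^sup>2) * \<bar>h x U\<bar> \<le> M * (V \<bullet> \<nu> x - a) * (U \<bullet> U)"
      if x: "x \<in> \<Sigma> \<inter> cball x0 R" and U: "U \<bullet> \<nu> x = 0" for x U
    proof (cases "U = 0")
      case True
      then show ?thesis using hscale[of x 0 0] x by simp
    next
      case False
      define U1 where "U1 = inverse (norm U) *\<^sub>R U"
      have U1: "U1 \<bullet> \<nu> x = 0" "norm U1 = 1" "U = norm U *\<^sub>R U1" using False U by (auto simp: U1_def)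
      have "(x, U1) \<in> K" using x U1 by (simp add: K_def)
      from max[OF this] have "(R\<^sup>2 - (norm (x - x0))\<^sup>2) * \<bar>h x U1\<bar> \<le> M * (V \<bullet> \<nu> x - a)"
        using wa[OF x] a by (simp add: \<Phi>_def M_def divide_le_eq)
      then have "(norm U)\<^sup>2 * ((R\<^sup>2 - (norm (x - x0))\<^sup>2) * \<bar>h x U1\<bar>) \<le> (norm U)\<^sup>2 * (M * (V \<bullet> \<nu> x - a))"
        by (rule mult_left_mono) simp
      moreover have "h x U = (norm U)\<^sup>2 * h x U1"
        using hscale[of x U1 "norm U"] x U1 by (simp add: power2_eq_square)
      then have "\<bar>h x U\<bar> = (norm U)\<^sup>2 * \<bar>h x U1\<bar>" by (simp add: abs_mult)
      ultimately show ?thesis by (simp add: power2_norm_eq_inner mult_ac)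
    qed
    have Z0: "0 \<le> Z" using a R by (simp add: Z_def)
    have "m\<^sup>2 \<le> Z"
    \<comment> \<open>If the maximum is 0, the bound is trivial; this covers maxima on the bounding
      sphere. Otherwise the point is interior and its curvature is nonzero.\<close>
    proof (cases "m = 0")
      case True
      then show ?thesis using Z0 by simp
    next
      case False
      then have pos: "0 < R\<^sup>2 - (norm (p - x0))\<^sup>2" "h p X \<noteq> 0"
        using h0[of p] p(1) by (auto simp: m_def)
      show ?thesis unfolding m_def h_def Z_def
      proof (rule maximum_point_estimate[OF tr _ R V a _ pos(1) p(2,3)])
        show "p \<in> \<Sigma>" using p(1) by simp
        show "a < V \<bullet> \<nu> p" using wp a by simp
        show "second_fundamental_form \<Sigma> \<nu> p X X \<noteq> 0" using pos(2) by (simp add: h_def)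
        show "M * (V \<bullet> \<nu> p - a) = (R\<^sup>2 - (norm (p - x0))\<^sup>2) * \<bar>second_fundamental_form \<Sigma> \<nu> p X X\<bar>"
          using Mm by (simp add: m_def h_def)
      qed (use bound in \<open>simp add: h_def\<close>)
    qed
    then have "m \<le> sqrt Z" by (rule real_le_rsqrt)
    \<comment> \<open>Because w - a is at least a at the maximum point, the bound for
      \<open>m\<close> gives one for \<open>M\<close> after division by \<open>a\<close>.\<close>
    moreover have "M * a \<le> m"
    proof -
      have "0 \<le> M" unfolding M_def \<Phi>_def using m0 wp a by (simp add: m_def)
      then have "M * a \<le> M * (V \<bullet> \<nu> p - a)" using wp by (rule mult_left_mono[rotated])
      then show ?thesis using Mm by simp
    qed
    ultimately have "M \<le> sqrt Z / a" using a by (simp add: le_divide_eq)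
    then have "M * (V \<bullet> \<nu> q - a) * (Y \<bullet> Y) \<le> sqrt Z / a * (V \<bullet> \<nu> q - a) * (Y \<bullet> Y)"
      using wa[OF q] a by (intro mult_right_mono) auto
    with bound[OF q Y] show ?thesis unfolding h_def Z_def by linarith
  qed
qed

theorem theorem5p2:
  fixes \<delta> :: real
  assumes "2 \<le> CARD('n::finite)" and "0 < \<delta>"
  shows "\<exists>C::real. \<forall>(R::real) (x0 :: 'n ambient) (V :: 'n ambient) (\<Sigma> :: 'n ambient set) \<nu>.
           0 < R \<longrightarrow> norm V = 1 \<longrightarrow> properly_embedded \<Sigma> \<longrightarrow> translator \<Sigma> \<nu> \<longrightarrow>
           (\<forall>x \<in> cball x0 R \<inter> \<Sigma>. \<delta> \<le> V \<bullet> \<nu> x) \<longrightarrow>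
           (\<forall>x \<in> cball x0 (R / 2) \<inter> \<Sigma>.
              (norm_second_fundamental_form \<Sigma> \<nu> x)\<^sup>2 \<le> C * (1 / R + 1 / R\<^sup>2) * (V \<bullet> \<nu> x)\<^sup>2)"
proof -
  define a where "a = \<delta> / 2"
  \<comment> \<open>The final 2 absorbs the term 2R of the estimate: the bracket is at most k (1 +
    R) for every R.\<close>
  define k where "k = 8 / a + 8 + 2 * real CARD('n) + 2"
  have a: "0 < a" using assms(2) by (simp add: a_def)
  have "(norm_second_fundamental_form \<Sigma> \<nu> x)\<^sup>2
      \<le> (real CARD('n))\<^sup>2 * (16 / 9 * (2 / a) * k / a\<^sup>2) * (1 / R + 1 / R\<^sup>2) * (V \<bullet> \<nu> x)\<^sup>2"
    if R: "0 < R" and V: "norm V = 1" and emb: "properly_embedded \<Sigma>" and tr: "translator \<Sigma> \<nu>"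
      and w: "\<forall>x \<in> cball x0 R \<inter> \<Sigma>. \<delta> \<le> V \<bullet> \<nu> x" and x: "x \<in> cball x0 (R / 2) \<inter> \<Sigma>"
    for R and x0 V x :: "'n ambient" and \<Sigma> \<nu>
  proof -
    have \<Sigma>: "smooth_hypersurface \<Sigma>" "unit_normal_field \<Sigma> \<nu>" using tr unfolding translator_def by auto
    define Z where "Z = 2 / a * R\<^sup>2 * (8 / a + 8 + 2 * real CARD('n) + 2 * R)"
    \<comment> \<open>The factor 4/3 inverts \<eta> \<ge> 3/4 R^2 on the half ball, whence the 16/9
      in the constant.\<close>
    define L where "L = 4 / (3 * R\<^sup>2) * (sqrt Z / a * (V \<bullet> \<nu> x))"
    have Z0: "0 \<le> Z" using a R by (simp add: Z_def)
    have xR: "x \<in> \<Sigma> \<inter> cball x0 R" using x R by auto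
    have wx: "\<delta> \<le> V \<bullet> \<nu> x" using w xR by blast
    have \<eta>: "3 / 4 * R\<^sup>2 \<le> R\<^sup>2 - (norm (x - x0))\<^sup>2"
    proof -
      have "norm (x - x0) \<le> R / 2" using x by (simp add: dist_norm norm_minus_commute)
      then have "(norm (x - x0))\<^sup>2 \<le> (R / 2)\<^sup>2" by (intro power_mono) auto
      then show ?thesis by (simp add: power2_eq_square)
    qed
    have "\<bar>second_fundamental_form \<Sigma> \<nu> x Y Y\<bar> \<le> L * (Y \<bullet> Y)" if Y: "Y \<bullet> \<nu> x = 0" for Y
    proof -
      have "3 / 4 * R\<^sup>2 * \<bar>second_fundamental_form \<Sigma> \<nu> x Y Y\<bar>
          \<le> (R\<^sup>2 - (norm (x - x0))\<^sup>2) * \<bar>second_fundamental_form \<Sigma> \<nu> x Y Y\<bar>"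
        using \<eta> by (intro mult_right_mono) auto
      also have "\<dots> \<le> sqrt Z / a * (V \<bullet> \<nu> x - a) * (Y \<bullet> Y)"
        using weighted_curvature_maximum[OF emb tr R V assms(2) _ xR Y] w unfolding Z_def a_def by blast
      \<comment> \<open>Dropping \<open>a\<close> leaves the factor w, whose square appears in the
        claim.\<close>
      also have "\<dots> \<le> sqrt Z / a * (V \<bullet> \<nu> x) * (Y \<bullet> Y)"
        using a Z0 by (intro mult_right_mono mult_left_mono) auto
      finally have "\<bar>second_fundamental_form \<Sigma> \<nu> x Y Y\<bar>
          \<le> sqrt Z / a * (V \<bullet> \<nu> x) * (Y \<bullet> Y) / (3 / 4 * R\<^sup>2)"
        using R by (subst pos_le_divide_eq) (auto simp: mult.commute)
      also have "\<dots> = L * (Y \<bullet> Y)" by (simp add: L_def mult_ac)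
      finally show ?thesis .
    qed
    then have "(norm_second_fundamental_form \<Sigma> \<nu> x)\<^sup>2 \<le> (real CARD('n))\<^sup>2 * L\<^sup>2"
      using xR by (intro norm_second_fundamental_form_le \<Sigma>) auto
    also have "L\<^sup>2 \<le> (16 / 9 * (2 / a) * k / a\<^sup>2) * (1 / R + 1 / R\<^sup>2) * (V \<bullet> \<nu> x)\<^sup>2"
    proof -
      have "L\<^sup>2 = 16 / 9 / (R\<^sup>2 * R\<^sup>2) * (Z / a\<^sup>2 * (V \<bullet> \<nu> x)\<^sup>2)"
        using Z0 by (simp add: L_def power_mult_distrib power_divide)
      also have "\<dots> \<le> 16 / 9 / (R\<^sup>2 * R\<^sup>2) * ((2 / a * R\<^sup>2 * (k * (1 + R))) / a\<^sup>2 * (V \<bullet> \<nu> x)\<^sup>2)"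
      proof -
        have "8 / a + 8 + 2 * real CARD('n) + 2 * R \<le> k * (1 + R)"
        proof -
          have "0 \<le> (8 / a + 8 + 2 * real CARD('n)) * R" using a R by simp
          moreover have "k * (1 + R) = 8 / a + 8 + 2 * real CARD('n) + 2
              + (8 / a + 8 + 2 * real CARD('n)) * R + 2 * R"
            by (simp only: k_def distrib_left distrib_right mult_1_right)
          ultimately show ?thesis by linarith
        qed
        then have "Z \<le> 2 / a * R\<^sup>2 * (k * (1 + R))"
          unfolding Z_def using a by (intro mult_left_mono) auto
        then show ?thesis
          by (intro mult_left_mono mult_right_mono divide_right_mono) auto
      qed
      also have "\<dots> = (16 / 9 * (2 / a) * k / a\<^sup>2) * (1 / R + 1 / R\<^sup>2) * (V \<bullet> \<nu> x)\<^sup>2"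
        using R a by (simp add: field_simps power2_eq_square)
      finally show ?thesis .
    qed
    finally show ?thesis by (simp add: mult_left_mono mult.assoc)
  qed
  then show ?thesis by blast
qed

end
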